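(* The equations $$\rho_k=0,\quad\rho_k=\infty,\quad\rho'_k=0,\quad\rho'_k=\infty,\qquad k=1,2,3,4,$$ define $16$ affine lines (not asserted to be pairwise distinct) on the affine Segre surface $\mathcal Y'\subset\mathbf C^4$: for each of these $16$ equations, the image under the natural isomorphism $\theta':\mathcal F\to\mathcal Y'$ of the locus it defines in $\mathcal F$ is an affine line of $\mathbf C^4$ contained in $\mathcal Y'$.
   Context: Fix $q\in\mathbf C^*$, $|q|<1$; for $c,d\in\mathbf C^*$ write $c\equiv d$ iff $c/d\in q^{\mathbf Z}$. Parameters: $R_1,R_2,\sigma_1,\sigma_2,x_1,\dots,x_4\in\mathbf C^*$, with $\omega:=\sigma_1/\sigma_2$, assumed to satisfy: (NR) $R_1\not\equiv R_2$, $\sigma_1\not\equiv\sigma_2$, and $x_k\not\equiv x_l$ for $k\ne l$; (FR) $x_1x_2x_3x_4=R_1R_2/(\sigma_1\sigma_2)$; (NS) $R_i/\sigma_j\not\equiv x_kx_l$ for all $i,j\in\{1,2\}$, $k\neq l$. Let $V_{i,j}:=\{m\in\mathcal O(\mathbf C^* )\mid m(qx)=(R_i/\sigma_j)x^{-2}m(x)\}$ (dimension 2), $V:=\prod_{i,j\in\{1,2\}}V_{i,j}$ (elements are $2\times2$ matrices $M=(m_{i,j})$), $V^{( * )}:=\prod(V_{i,j}\setminus\{0\})$. The torus $H:=(D_2(\mathbf C)\times D_2(\mathbf C))/\mathbf C^*(I_2,I_2)$ ($D_2(\mathbf C)$: invertible diagonal matrices) acts by $(\Gamma,\Delta).M=\Gamma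 M\Delta^{-1}$. Let $F:=\{M\in V\mid\det M\not\equiv0\text{ as a function},\ \det M(x_k)=0,\ k=1,\dots,4\}\subset V^{( * )}$, and let $\mathcal F$ be its image in the geometric quotient $V^{( * )}/H$. For $M\in F$, each $M(x_k)$ has rank 1. With values in $\mathbf P^1(\mathbf C)=\mathbf C\cup\{\infty\}$, set $\rho_k(M):=m_{i,2}(x_k)/m_{i,1}(x_k)$ (for any $i$ such that the $i$-th row of $M(x_k)$ is nonzero) and $\rho'_k(M):=m_{1,j}(x_k)/m_{2,j}(x_k)$ (for any $j$ such that the $j$-th column of $M(x_k)$ is nonzero). Under $H$ the $\rho_k$ (resp. the $\rho'_k$) are all multiplied by a common nonzero constant, so the loci $\rho_k=0,\infty$ and $\rho'_k=0,\infty$ are well defined in $\mathcal F$. For a pair $(s_1,s_2)\in(\mathbf C^* )^2$ and $j=1,2$ define $\lambda_j,\mu_j,\lambda'_j,\mu'_j$ by $m(x_3)=\lambda_jm(x_1)+\mu_jm(x_2)$, $m(x_4)=\lambda'_jm(x_1)+\mu'_jm(x_2)$ for all $m\in\mathcal O(\mathbf C^* )$ with $m(qx)=(R_1/s_j)x^{-2}m(x)$, and write, in variables $\rho_1,\dots,\rho_4$, $$(\lambda_2\rho_1-\lambda_1\rho_3)(\mu'_2\rho_2-\mu'_1\rho_4)-(\lambda'_2\rho_1-\lambda'_1\rho_4)(\mu_2\rho_2-\mu_1\rho_3)=\sum_{1\le k<l\le4}a_{kl}\,\rho_k\rho_l .$$ Let $\Phi=\sum a_{kl}\rho_k\rho_l$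 be this quadratic form for $(s_1,s_2)=(\sigma_1,\sigma_2)=(\omega\sigma_2,\sigma_2)$, and $\Phi'=\sum a'_{kl}\rho_k\rho_l$ the form for $(s_1,s_2)=(\sigma_2,\sigma_2)$, i.e. its value at $\omega=1$ with $\sigma_2,R_1,R_2,x_1,\dots,x_4$ kept fixed. Let $\mathcal Y\subset\mathbf C^6$ (coordinates $\eta_{kl}$, $1\le k<l\le4$) be defined by $$\sum a_{kl}\eta_{kl}=0,\quad\sum a'_{kl}\eta_{kl}=1,\quad\eta_{12}\eta_{34}-\eta_{13}\eta_{24}=0,\quad\eta_{13}\eta_{24}-\eta_{14}\eta_{23}=0.$$ The formulas $\eta_{kl}=\rho_k\rho_l/\Phi'(\rho)$ (read in multihomogeneous form on $(\mathbf P^1(\mathbf C))^4$: put $\rho_k=\rho_k^x/\rho_k^y$ and multiply numerator and denominator by $\prod_k\rho_k^y$), evaluated at $\rho=(\rho_k(M))_k$, induce the natural isomorphism $\theta:\mathcal F\to\mathcal Y$. The parameters are taken generic, so that two coordinates can be eliminated: in the coordinates $(\eta_{12},\eta_{13},\eta_{14},\eta_{23})$, $\mathcal Y$ is isomorphic to an intersection $\mathcal Y'$ of two quadrics in $\mathbf C^4$, the affine Segre surface; $\theta':\mathcal F\to\mathcal Y'$ is $\theta$ followed by this isomorphism.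
   Formalization: Assumes explicitly that Φ'(ρ(M)) ≠ 0 for every M in F, so that θ is defined on all of 𝓕; with Φ' taken literally at ω=1 this fails for generic parameters and holds only on a special family. Genericity is read as solvability of the two linear equations for η24, η34. *)

theory Defs
  imports "HOL-Complex_Analysis.Complex_Analysis"
begin

definition qequiv :: "complex \<Rightarrow> complex \<Rightarrow> complex \<Rightarrow> bool" where
  "qequiv q c d \<longleftrightarrow> (\<exists>n::int. c / d = q powi n)"

text \<open>
  Functions on the punctured plane are total functions here; \<open>m 0 = 0\<close> fixes the irrelevant value
  at the origin, so that equality of functions is equality on the punctured plane.
\<close>

definition theta_space :: "complex \<Rightarrow> complex \<Rightarrow> (complex \<Rightarrow> complex) set" where
  "theta_space q c =
     {m. m holomorphic_on (- {0}) \<and> m 0 = 0 \<and> (\<forall>z. z \<noteq> 0 \<longrightarrow> m (q * z) = c / z ^ 2 * m z)}"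

definition V_space :: "complex \<Rightarrow> complex ^ 2 \<Rightarrow> complex ^ 2 \<Rightarrow> (complex \<Rightarrow> complex ^ 2 ^ 2) set" where
  "V_space q R \<sigma> = {M. \<forall>i j. (\<lambda>z. M z $ i $ j) \<in> theta_space q (R $ i / \<sigma> $ j)}"

definition V_star :: "complex \<Rightarrow> complex ^ 2 \<Rightarrow> complex ^ 2 \<Rightarrow> (complex \<Rightarrow> complex ^ 2 ^ 2) set" where
  "V_star q R \<sigma> = {M \<in> V_space q R \<sigma>. \<forall>i j. \<exists>z. M z $ i $ j \<noteq> 0}"

definition F_set :: "complex \<Rightarrow> complex ^ 2 \<Rightarrow> complex ^ 2 \<Rightarrow> (nat \<Rightarrow> complex)
    \<Rightarrow> (complex \<Rightarrow> complex ^ 2 ^ 2) set" where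
  "F_set q R \<sigma> x =
     {M \<in> V_space q R \<sigma>. (\<exists>z. det (M z) \<noteq> 0) \<and> (\<forall>k\<in>{1..4}. det (M (x k)) = 0)}"

definition D2 :: "(complex ^ 2 ^ 2) set" where
  "D2 = {A. invertible A \<and> (\<forall>i j. i \<noteq> j \<longrightarrow> A $ i $ j = 0)}"

text \<open>
  The orbit relation of the torus on \<open>V_star\<close>. The scalar pairs, by which the torus is divided,
  act trivially, so they need not be divided out to form orbits.
\<close>

definition H_rel :: "complex \<Rightarrow> complex ^ 2 \<Rightarrow> complex ^ 2
    \<Rightarrow> ((complex \<Rightarrow> complex ^ 2 ^ 2) \<times> (complex \<Rightarrow> complex ^ 2 ^ 2)) set" where
  "H_rel q R \<sigma> =
     {(M, N). M \<in> V_star q R \<sigma> \<and>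
        (\<exists>\<Gamma>\<in>D2. \<exists>\<Delta>\<in>D2. N = (\<lambda>z. \<Gamma> ** M z ** matrix_inv \<Delta>))}"

definition H_orbit :: "complex \<Rightarrow> complex ^ 2 \<Rightarrow> complex ^ 2 \<Rightarrow> (complex \<Rightarrow> complex ^ 2 ^ 2)
    \<Rightarrow> (complex \<Rightarrow> complex ^ 2 ^ 2) set" where
  "H_orbit q R \<sigma> M = H_rel q R \<sigma> `` {M}"

text \<open>
  Under (NS) every \<open>M \<in> F_set\<close> lies in \<open>V_star\<close> and \<open>F_set\<close> is stable under the torus, so
  \<open>H_orbit\<close> restricts to the quotient map \<open>F_set \<rightarrow> F_quot\<close>.
\<close>

definition F_quot :: "complex \<Rightarrow> complex ^ 2 \<Rightarrow> complex ^ 2 \<Rightarrow> (nat \<Rightarrow> complex)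
    \<Rightarrow> (complex \<Rightarrow> complex ^ 2 ^ 2) set set" where
  "F_quot q R \<sigma> x = H_orbit q R \<sigma> ` F_set q R \<sigma> x"

datatype P1 = Fin complex | Infty

definition P1_ratio :: "complex \<Rightarrow> complex \<Rightarrow> P1" where
  "P1_ratio a b = (if b = 0 then Infty else Fin (a / b))"

text \<open>Homogeneous coordinates \<open>(hx p, hy p)\<close> of a point \<open>p = hx p / hy p\<close>.\<close>

fun hx :: "P1 \<Rightarrow> complex" where
  "hx (Fin z) = z"
| "hx Infty = 1"

fun hy :: "P1 \<Rightarrow> complex" where
  "hy (Fin z) = 1"
| "hy Infty = 0"

definition rho :: "(nat \<Rightarrow> complex) \<Rightarrow> (complex \<Rightarrow> complex ^ 2 ^ 2) \<Rightarrow> nat \<Rightarrow> P1" where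
  "rho x M k = (let i = (SOME i. row i (M (x k)) \<noteq> 0)
                in P1_ratio (M (x k) $ i $ 2) (M (x k) $ i $ 1))"

definition rho' :: "(nat \<Rightarrow> complex) \<Rightarrow> (complex \<Rightarrow> complex ^ 2 ^ 2) \<Rightarrow> nat \<Rightarrow> P1" where
  "rho' x M k = (let j = (SOME j. column j (M (x k)) \<noteq> 0)
                 in P1_ratio (M (x k) $ 1 $ j) (M (x k) $ 2 $ j))"

text \<open>
  The coordinates of \<open>m (x k)\<close> with respect to \<open>m (x 1)\<close> and \<open>m (x 2)\<close>: with \<open>c = R $ 1 / s\<^sub>j\<close>,
  the pair \<open>(\<lambda>\<^sub>j, \<mu>\<^sub>j)\<close> is the case \<open>k = 3\<close>, and \<open>(\<lambda>'\<^sub>j, \<mu>'\<^sub>j)\<close> is the case \<open>k = 4\<close>.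
\<close>

definition interp :: "complex \<Rightarrow> complex \<Rightarrow> (nat \<Rightarrow> complex) \<Rightarrow> nat \<Rightarrow> complex \<times> complex" where
  "interp q c x k =
     (THE p. \<forall>m\<in>theta_space q c. m (x k) = fst p * m (x 1) + snd p * m (x 2))"

abbreviation lam :: "complex \<Rightarrow> complex \<Rightarrow> (nat \<Rightarrow> complex) \<Rightarrow> nat \<Rightarrow> complex" where
  "lam q c x k \<equiv> fst (interp q c x k)"

abbreviation mu :: "complex \<Rightarrow> complex \<Rightarrow> (nat \<Rightarrow> complex) \<Rightarrow> nat \<Rightarrow> complex" where
  "mu q c x k \<equiv> snd (interp q c x k)"

text \<open>
  The coefficients \<open>a\<^sub>k\<^sub>l\<close> of the quadratic form, in the order 12, 13, 14, 23, 24, 34, for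
  \<open>c1 = R $ 1 / s\<^sub>1\<close> and \<open>c2 = R $ 1 / s\<^sub>2\<close>; lemma \<open>quad_form_expansion\<close> recovers the form they come
  from.
\<close>

definition a12 where
  "a12 q c1 c2 x = lam q c2 x 3 * mu q c2 x 4 - lam q c2 x 4 * mu q c2 x 3"
definition a13 where
  "a13 q c1 c2 x = lam q c2 x 4 * mu q c1 x 3"
definition a14 where
  "a14 q c1 c2 x = - (lam q c2 x 3 * mu q c1 x 4)"
definition a23 where
  "a23 q c1 c2 x = - (lam q c1 x 3 * mu q c2 x 4)"
definition a24 where
  "a24 q c1 c2 x = lam q c1 x 4 * mu q c2 x 3"
definition a34 where
  "a34 q c1 c2 x = lam q c1 x 3 * mu q c1 x 4 - lam q c1 x 4 * mu q c1 x 3"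

lemma quad_form_expansion:
  fixes \<rho> :: "nat \<Rightarrow> complex"
  shows
   "(lam q c2 x 3 * \<rho> 1 - lam q c1 x 3 * \<rho> 3) * (mu q c2 x 4 * \<rho> 2 - mu q c1 x 4 * \<rho> 4)
      - (lam q c2 x 4 * \<rho> 1 - lam q c1 x 4 * \<rho> 4) * (mu q c2 x 3 * \<rho> 2 - mu q c1 x 3 * \<rho> 3)
    = a12 q c1 c2 x * \<rho> 1 * \<rho> 2 + a13 q c1 c2 x * \<rho> 1 * \<rho> 3 + a14 q c1 c2 x * \<rho> 1 * \<rho> 4
      + a23 q c1 c2 x * \<rho> 2 * \<rho> 3 + a24 q c1 c2 x * \<rho> 2 * \<rho> 4 + a34 q c1 c2 x * \<rho> 3 * \<rho> 4"
  unfolding a12_def a13_def a14_def a23_def a24_def a34_def by (simp add: algebra_simps)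

text \<open>A linear form on six-dimensional space, with coordinates ordered 12, 13, 14, 23, 24, 34.\<close>

type_synonym C6 = "complex \<times> complex \<times> complex \<times> complex \<times> complex \<times> complex"

definition lin_form :: "complex \<Rightarrow> complex \<Rightarrow> complex \<Rightarrow> (nat \<Rightarrow> complex) \<Rightarrow> C6 \<Rightarrow> complex" where
  "lin_form q c1 c2 x = (\<lambda>(e12, e13, e14, e23, e24, e34).
     a12 q c1 c2 x * e12 + a13 q c1 c2 x * e13 + a14 q c1 c2 x * e14
     + a23 q c1 c2 x * e23 + a24 q c1 c2 x * e24 + a34 q c1 c2 x * e34)"

text \<open>
  \<open>hmon \<rho> k l\<close> is the monomial \<open>\<rho>\<^sub>k \<rho>\<^sub>l\<close> multiplied by the product of all four denominators
  \<open>hy (\<rho> m)\<close>.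
\<close>

definition hmon :: "(nat \<Rightarrow> P1) \<Rightarrow> nat \<Rightarrow> nat \<Rightarrow> complex" where
  "hmon \<rho> k l = (\<Prod>m\<in>{1..4}. if m = k \<or> m = l then hx (\<rho> m) else hy (\<rho> m))"

definition hmons :: "(nat \<Rightarrow> P1) \<Rightarrow> C6" where
  "hmons \<rho> = (hmon \<rho> 1 2, hmon \<rho> 1 3, hmon \<rho> 1 4, hmon \<rho> 2 3, hmon \<rho> 2 4, hmon \<rho> 3 4)"

text \<open>The multihomogeneous form of \<open>\<Phi>'\<close>, with \<open>s\<^sub>1 = s\<^sub>2 = \<sigma> $ 2\<close>.\<close>

definition Phi' :: "complex \<Rightarrow> complex ^ 2 \<Rightarrow> complex ^ 2 \<Rightarrow> (nat \<Rightarrow> complex)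
    \<Rightarrow> (nat \<Rightarrow> P1) \<Rightarrow> complex" where
  "Phi' q R \<sigma> x \<rho> = lin_form q (R $ 1 / \<sigma> $ 2) (R $ 1 / \<sigma> $ 2) x (hmons \<rho>)"

definition eta :: "complex \<Rightarrow> complex ^ 2 \<Rightarrow> complex ^ 2 \<Rightarrow> (nat \<Rightarrow> complex)
    \<Rightarrow> (nat \<Rightarrow> P1) \<Rightarrow> C6" where
  "eta q R \<sigma> x \<rho> = (case hmons \<rho> of (h12, h13, h14, h23, h24, h34) \<Rightarrow>
     (h12 / Phi' q R \<sigma> x \<rho>, h13 / Phi' q R \<sigma> x \<rho>, h14 / Phi' q R \<sigma> x \<rho>,
      h23 / Phi' q R \<sigma> x \<rho>, h24 / Phi' q R \<sigma> x \<rho>, h34 / Phi' q R \<sigma> x \<rho>))"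

definition Y_surf :: "complex \<Rightarrow> complex ^ 2 \<Rightarrow> complex ^ 2 \<Rightarrow> (nat \<Rightarrow> complex) \<Rightarrow> C6 set" where
  "Y_surf q R \<sigma> x =
     {(e12, e13, e14, e23, e24, e34).
        lin_form q (R $ 1 / \<sigma> $ 1) (R $ 1 / \<sigma> $ 2) x (e12, e13, e14, e23, e24, e34) = 0 \<and>
        lin_form q (R $ 1 / \<sigma> $ 2) (R $ 1 / \<sigma> $ 2) x (e12, e13, e14, e23, e24, e34) = 1 \<and>
        e12 * e34 - e13 * e24 = 0 \<and> e13 * e24 - e14 * e23 = 0}"

text \<open>
  The determinant of the two linear equations of \<open>Y_surf\<close> in the unknowns \<open>e24\<close>, \<open>e34\<close>: when it is
  nonzero, these two coordinates are eliminated by Cramer's rule.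
\<close>

definition elim_det :: "complex \<Rightarrow> complex ^ 2 \<Rightarrow> complex ^ 2 \<Rightarrow> (nat \<Rightarrow> complex) \<Rightarrow> complex" where
  "elim_det q R \<sigma> x = (let c1 = R $ 1 / \<sigma> $ 1; c2 = R $ 1 / \<sigma> $ 2 in
     a24 q c1 c2 x * a34 q c2 c2 x - a34 q c1 c2 x * a24 q c2 c2 x)"

definition elim24 :: "complex \<Rightarrow> complex ^ 2 \<Rightarrow> complex ^ 2 \<Rightarrow> (nat \<Rightarrow> complex)
    \<Rightarrow> complex ^ 4 \<Rightarrow> complex" where
  "elim24 q R \<sigma> x y = (let c1 = R $ 1 / \<sigma> $ 1; c2 = R $ 1 / \<sigma> $ 2;
       b = - lin_form q c1 c2 x (y $ 1, y $ 2, y $ 3, y $ 4, 0, 0);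
       b' = 1 - lin_form q c2 c2 x (y $ 1, y $ 2, y $ 3, y $ 4, 0, 0) in
     (b * a34 q c2 c2 x - a34 q c1 c2 x * b') / elim_det q R \<sigma> x)"

definition elim34 :: "complex \<Rightarrow> complex ^ 2 \<Rightarrow> complex ^ 2 \<Rightarrow> (nat \<Rightarrow> complex)
    \<Rightarrow> complex ^ 4 \<Rightarrow> complex" where
  "elim34 q R \<sigma> x y = (let c1 = R $ 1 / \<sigma> $ 1; c2 = R $ 1 / \<sigma> $ 2;
       b = - lin_form q c1 c2 x (y $ 1, y $ 2, y $ 3, y $ 4, 0, 0);
       b' = 1 - lin_form q c2 c2 x (y $ 1, y $ 2, y $ 3, y $ 4, 0, 0) in
     (a24 q c1 c2 x * b' - b * a24 q c2 c2 x) / elim_det q R \<sigma> x)"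

definition Y'_surf :: "complex \<Rightarrow> complex ^ 2 \<Rightarrow> complex ^ 2 \<Rightarrow> (nat \<Rightarrow> complex)
    \<Rightarrow> (complex ^ 4) set" where
  "Y'_surf q R \<sigma> x =
     {y. y $ 1 * elim34 q R \<sigma> x y - y $ 2 * elim24 q R \<sigma> x y = 0 \<and>
         y $ 2 * elim24 q R \<sigma> x y - y $ 3 * y $ 4 = 0}"

definition pr4 :: "C6 \<Rightarrow> complex ^ 4" where
  "pr4 = (\<lambda>(e12, e13, e14, e23, e24, e34). vector [e12, e13, e14, e23])"

lemma vector_4 [simp]:
  "(vector [a, b, c, d] :: 'a::zero ^ 4) $ 1 = a"
  "(vector [a, b, c, d] :: 'a::zero ^ 4) $ 2 = b"
  "(vector [a, b, c, d] :: 'a::zero ^ 4) $ 3 = c"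
  "(vector [a, b, c, d] :: 'a::zero ^ 4) $ 4 = d"
  unfolding vector_def by simp_all

lemma cramer2:
  fixes p r p' r' b b' u v :: complex
  assumes "p * r' - r * p' \<noteq> 0"
  shows "(p * u + r * v = b \<and> p' * u + r' * v = b') \<longleftrightarrow>
         (u = (b * r' - r * b') / (p * r' - r * p') \<and> v = (p * b' - b * p') / (p * r' - r * p'))"
    (is "?L \<longleftrightarrow> ?R")
proof
  assume ?L
  then show ?R using assms by (auto simp: field_simps)
next
  assume R: ?R
  let ?D = "p * r' - r * p'"
  have u: "?D * u = b * r' - r * b'" and v: "?D * v = p * b' - b * p'"
    using R assms by auto
  have "?D * (p * u + r * v) = p * (?D * u) + r * (?D * v)" by algebra
  also have "\<dots> = ?D * b" unfolding u v by algebra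
  finally have 1: "p * u + r * v = b" using assms by simp
  have "?D * (p' * u + r' * v) = p' * (?D * u) + r' * (?D * v)" by algebra
  also have "\<dots> = ?D * b'" unfolding u v by algebra
  finally have "p' * u + r' * v = b'" using assms by simp
  with 1 show ?L by simp
qed

lemma bij_betw_pr4:
  assumes "elim_det q R \<sigma> x \<noteq> 0"
  shows "bij_betw pr4 (Y_surf q R \<sigma> x) (Y'_surf q R \<sigma> x)"
proof -
  define c1 c2 where c: "c1 = R $ 1 / \<sigma> $ 1" "c2 = R $ 1 / \<sigma> $ 2"
  have D: "a24 q c1 c2 x * a34 q c2 c2 x - a34 q c1 c2 x * a24 q c2 c2 x \<noteq> 0"
    using assms by (simp add: elim_det_def c Let_def)
  have key: "(lin_form q c1 c2 x (y $ 1, y $ 2, y $ 3, y $ 4, u, v) = 0 \<and>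
              lin_form q c2 c2 x (y $ 1, y $ 2, y $ 3, y $ 4, u, v) = 1) \<longleftrightarrow>
             (u = elim24 q R \<sigma> x y \<and> v = elim34 q R \<sigma> x y)" for y u v
  proof -
    have split: "lin_form q d1 d2 x (y $ 1, y $ 2, y $ 3, y $ 4, u, v) =
        lin_form q d1 d2 x (y $ 1, y $ 2, y $ 3, y $ 4, 0, 0)
        + (a24 q d1 d2 x * u + a34 q d1 d2 x * v)" for d1 d2
      by (simp add: lin_form_def)
    have move: "s + t = 0 \<longleftrightarrow> t = - s" "s + t = 1 \<longleftrightarrow> t = 1 - s" for s t :: complex
      by (auto simp: algebra_simps eq_neg_iff_add_eq_0)
    show ?thesis
      unfolding split[of c1 c2] split[of c2 c2] move cramer2[OF D]
      by (simp add: elim24_def elim34_def elim_det_def Let_def flip: c)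
  qed
  define g where "g y = (y $ 1, y $ 2, y $ 3, y $ 4, elim24 q R \<sigma> x y, elim34 q R \<sigma> x y)"
    for y :: "complex ^ 4"
  show ?thesis
  proof (rule bij_betw_byWitness[where f' = g])
    show "\<forall>e\<in>Y_surf q R \<sigma> x. g (pr4 e) = e"
    proof
      fix e assume e: "e \<in> Y_surf q R \<sigma> x"
      obtain e12 e13 e14 e23 e24 e34 where ee: "e = (e12, e13, e14, e23, e24, e34)"
        by (cases e) auto
      show "g (pr4 e) = e"
        using e key[of "vector [e12, e13, e14, e23]" e24 e34]
        by (simp add: ee g_def pr4_def Y_surf_def flip: c)
    qed
    show "\<forall>y\<in>Y'_surf q R \<sigma> x. pr4 (g y) = y"
      by (simp add: g_def pr4_def vec_eq_iff forall_4)
    show "pr4 ` Y_surf q R \<sigma> x \<subseteq> Y'_surf q R \<sigma> x"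
    proof
      fix y assume "y \<in> pr4 ` Y_surf q R \<sigma> x"
      then obtain e12 e13 e14 e23 e24 e34
        where e: "(e12, e13, e14, e23, e24, e34) \<in> Y_surf q R \<sigma> x"
          and y: "y = vector [e12, e13, e14, e23]"
        by (auto simp: pr4_def)
      show "y \<in> Y'_surf q R \<sigma> x"
        using e key[of y e24 e34] by (simp add: y Y_surf_def Y'_surf_def flip: c)
    qed
    show "g ` Y'_surf q R \<sigma> x \<subseteq> Y_surf q R \<sigma> x"
      using key by (auto simp: g_def Y_surf_def Y'_surf_def simp flip: c)
  qed
qed

text \<open>
  \<open>eta\<close> at \<open>rho x M\<close> depends only on the orbit of \<open>M\<close>, because the numerators and \<open>Phi'\<close> are
  quadratic and the torus multiplies all \<open>\<rho>\<^sub>k\<close> by a common constant.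
\<close>

definition theta :: "complex \<Rightarrow> complex ^ 2 \<Rightarrow> complex ^ 2 \<Rightarrow> (nat \<Rightarrow> complex)
    \<Rightarrow> (complex \<Rightarrow> complex ^ 2 ^ 2) set \<Rightarrow> C6" where
  "theta q R \<sigma> x \<O> = the_elem ((\<lambda>M. eta q R \<sigma> x (rho x M)) ` \<O>)"

definition theta' :: "complex \<Rightarrow> complex ^ 2 \<Rightarrow> complex ^ 2 \<Rightarrow> (nat \<Rightarrow> complex)
    \<Rightarrow> (complex \<Rightarrow> complex ^ 2 ^ 2) set \<Rightarrow> complex ^ 4" where
  "theta' q R \<sigma> x \<O> = pr4 (theta q R \<sigma> x \<O>)"

definition rho_locus :: "complex \<Rightarrow> complex ^ 2 \<Rightarrow> complex ^ 2 \<Rightarrow> (nat \<Rightarrow> complex)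
    \<Rightarrow> nat \<Rightarrow> P1 \<Rightarrow> (complex \<Rightarrow> complex ^ 2 ^ 2) set set" where
  "rho_locus q R \<sigma> x k p = {\<O> \<in> F_quot q R \<sigma> x. \<forall>M\<in>\<O>. rho x M k = p}"

definition rho'_locus :: "complex \<Rightarrow> complex ^ 2 \<Rightarrow> complex ^ 2 \<Rightarrow> (nat \<Rightarrow> complex)
    \<Rightarrow> nat \<Rightarrow> P1 \<Rightarrow> (complex \<Rightarrow> complex ^ 2 ^ 2) set set" where
  "rho'_locus q R \<sigma> x k p = {\<O> \<in> F_quot q R \<sigma> x. \<forall>M\<in>\<O>. rho' x M k = p}"

definition affine_line :: "(complex ^ 'n) set \<Rightarrow> bool" where
  "affine_line L \<longleftrightarrow> (\<exists>p v. v \<noteq> 0 \<and> L = range (\<lambda>t. p + t *s v))"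

end

theory Submission
  imports Defs
begin

text \<open>
  Under the non-splitting condition, a function of degree two that vanishes at \<open>x\<^sub>k\<close> is unique up to
  a factor. Hence, up to the torus, each of the four loci at \<open>x\<^sub>k\<close> consists of the matrices one
  column (for \<open>\<rho>\<^sub>k\<close>) or one row (for \<open>\<rho>'\<^sub>k\<close>) of which is a fixed pair \<open>f\<close>. The other column or row
  \<open>g\<close> is proportional to \<open>f\<close> at the remaining three points, and it is determined by the ratios \<open>s, t\<close>
  at two of them: proportionality at the last point comes for free from the Fuchs relation, which
  also gives \<open>det M = \<delta>(s, t) \<Theta>\<close> with a fixed function \<open>\<Theta>\<close> and a nonzero linear form \<open>\<delta>\<close>. So the locus
  is the part \<open>\<delta> \<noteq> 0\<close> of a projective line. The numerators of the \<open>\<eta>\<^sub>k\<^sub>l\<close> are linear in \<open>(s, t)\<close>, and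
  \<open>\<Phi>'\<close> becomes a linear form that has no zero where \<open>\<delta> \<noteq> 0\<close>. It is therefore proportional to \<open>\<delta>\<close>,
  and the image of the locus is the affine line \<open>\<Phi>' = 1\<close>.
\<close>

text \<open>Rows and columns share one locale because transposition exchanges the parameters
  \<open>R\<close> with the inverses of \<open>\<sigma>\<close> and preserves all conditions. The
  two cases differ in how the ratios depend on \<open>(s, t)\<close>. With a column prescribed,
  \<open>\<rho>\<^sub>k\<close> stays at 0 or infinity and the other three ratios, or their
  inverses, are linear in \<open>(s, t)\<close>. With a row prescribed, those three are constant up
  to the torus and only \<open>\<rho>\<^sub>k\<close> moves. What has to be excluded is
  degeneration: \<delta> could vanish identically, which would make the locus empty;
  \<open>(s, t)\<close> could be lost in the six monomials; the line could collapse under the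
  projection to four coordinates. The first two are excluded by the non-resonance and non-splitting
  conditions with the Fuchs relation, the third by the injectivity of the projection on the surface.
  No dimension of a space of theta functions is computed. Its place is taken by one fact: a function
  of degree two with incongruent zeros \<open>a\<close>, \<open>b\<close> vanishes identically
  unless \<open>a * b\<close> is congruent to its multiplier.\<close>

no_notation fps_nth (infixl "$" 75)

section \<open>Theta functions\<close>

text \<open>The q-Pochhammer symbol (z; q)_infinity.\<close>

definition qprod :: "complex \<Rightarrow> complex \<Rightarrow> complex" where
  "qprod q z = (\<Prod>n. 1 - q ^ n * z)"

text \<open>Jacobi's theta function in product form, without the constant factor (q; q)_infinity.
  Its zeros are simple and form the group q^Z, so its translates serve as prime factors for all
  functions below.\<close>

definition qtheta :: "complex \<Rightarrow> complex \<Rightarrow> complex" where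
  "qtheta q z = qprod q z * qprod q (q / z)"

locale nome =
  fixes q :: complex
  assumes q_nonzero [simp]: "q \<noteq> 0" and norm_q: "norm q < 1"
begin

text \<open>Genus 0 suffices because the inverses of the zeros form a geometric series; the
  elementary factors are then \<open>1 - q ^ n * z\<close>.\<close>

sublocale qp: weierstrass_product "\<lambda>n. 1 / q ^ n" "\<lambda>_. 0"
proof
  show "filterlim (\<lambda>n. 1 / q ^ n) at_infinity sequentially"
  proof -
    have "(\<lambda>n. q ^ n) \<longlonglongrightarrow> 0"
      using norm_q by (rule LIMSEQ_power_zero)
    hence "filterlim (\<lambda>n. q ^ n) (at 0) sequentially"
      by (simp add: filterlim_at)
    from filterlim_compose[OF filterlim_inverse_at_infinity this]
    show ?thesis by (simp add: divide_inverse)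
  qed
  show "summable (\<lambda>n. (r / norm (1 / q ^ n)) ^ Suc 0)" if "r > 0" for r
    using norm_q by (simp add: norm_divide norm_power summable_mult summable_geometric)
qed auto

lemma qp_f_eq: "qp.f = qprod q"
  by (rule ext) (simp add: qp.f_def qprod_def weierstrass_factor_def mult.commute)

lemma qprod_holomorphic: "qprod q holomorphic_on A"
  using qp.holomorphic by (simp add: qp_f_eq)

lemma qprod_eq_0_iff: "qprod q z = 0 \<longleftrightarrow> (\<exists>n. q ^ n * z = 1)"
  using qp.zero[of z] by (auto simp: qp_f_eq field_simps)

lemma has_prod_qprod: "(\<lambda>n. 1 - q ^ n * z) has_prod qprod q z"
  using qp.has_prod[of z] by (simp add: qp_f_eq weierstrass_factor_def mult.commute)

lemma qprod_rec: "qprod q z = (1 - z) * qprod q (q * z)"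
proof -
  have "(\<lambda>n. 1 - q ^ n * z) has_prod (qprod q (q * z) * (1 - q ^ 0 * z))"
  proof (cases "z = 1")
    case True
    then show ?thesis
      using has_prod_qprod[of 1] by (simp add: qprod_eq_0_iff[THEN iffD2, of 1] exI[of _ 0])
  next
    case False
    have *: "(\<lambda>n. 1 - q ^ Suc n * z) has_prod qprod q (q * z)"
      using has_prod_qprod[of "q * z"] by (simp add: mult_ac)
    show ?thesis
      by (rule has_prod_Suc_imp) (rule *)
  qed
  from has_prod_unique2[OF has_prod_qprod[of z] this] show ?thesis by simp
qed

lemma qprod_inverse_holomorphic: "(\<lambda>z. qprod q (q / z)) holomorphic_on - {0}"
proof -
  have "(\<lambda>z. q / z) holomorphic_on - {0}"
    by (intro holomorphic_intros) auto
  from holomorphic_on_compose_gen[OF this qprod_holomorphic, of UNIV] show ?thesis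
    by (simp add: o_def)
qed

lemma qtheta_holomorphic: "qtheta q holomorphic_on - {0}"
proof -
  have "(\<lambda>z. qprod q (q / z)) holomorphic_on - {0}"
    by (rule qprod_inverse_holomorphic)
  thus ?thesis
    unfolding qtheta_def [abs_def] by (intro holomorphic_intros qprod_holomorphic)
qed

lemma qtheta_scaled_holomorphic:
  assumes "a \<noteq> 0"
  shows "(\<lambda>z. qtheta q (z * a)) holomorphic_on - {0}"
proof -
  have "(\<lambda>z. z * a) holomorphic_on - {0}"
    by (intro holomorphic_intros)
  moreover have "(\<lambda>z. z * a) ` (- {0}) \<subseteq> - {0}" using assms by auto
  ultimately show ?thesis
    using holomorphic_on_compose_gen[OF _ qtheta_holomorphic] by (simp add: o_def)
qed

text \<open>The shift takes the factor \<open>1 - z\<close> out of one product and brings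
  \<open>1 - 1 / z\<close> into the other; their quotient is \<open>- 1 / z\<close>.\<close>

lemma qtheta_shift:
  assumes "z \<noteq> 0"
  shows "qtheta q (q * z) = - qtheta q z / z"
proof -
  have "qtheta q z = (1 - z) * qprod q (q * z) * qprod q (q / z)"
    by (simp add: qtheta_def qprod_rec[of z])
  moreover have "qtheta q (q * z) = qprod q (q * z) * ((1 - 1 / z) * qprod q (q / z))"
    using qprod_rec[of "1 / z"] by (simp add: qtheta_def)
  ultimately show ?thesis using assms by (simp add: divide_simps) (simp add: algebra_simps)
qed

text \<open>The constant is (-1)^k q^(-k(k-1)/2); the application asks for
  \<open>C \<noteq> 0\<close> alone. It carries the local shape of the zero at 1 to the zero at
  \<open>q powi k\<close>.\<close>

lemma qtheta_shift_int:
  "\<exists>C. C \<noteq> 0 \<and> (\<forall>z. z \<noteq> 0 \<longrightarrow> qtheta q (q powi k * z) = C * z powi (- k) * qtheta q z)"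
proof (induction k rule: int_induct[where k = 0])
  case base
  show ?case by (intro exI[of _ 1]) simp
next
  case (step1 i)
  then obtain C where C: "C \<noteq> 0" "\<And>z. z \<noteq> 0 \<Longrightarrow> qtheta q (q powi i * z) = C * z powi (- i) * qtheta q z"
    by blast
  have "qtheta q (q powi (i + 1) * z) = (- C / q powi i) * z powi (- (i + 1)) * qtheta q z"
    if z: "z \<noteq> 0" for z
  proof -
    have "q powi (i + 1) * z = q * (q powi i * z)" by (simp add: power_int_add)
    moreover have "z powi (- (i + 1)) = z powi (- i) / z"
      using z power_int_diff[of z "- i" 1] by simp
    ultimately show ?thesis
      using qtheta_shift[of "q powi i * z"] C(2)[OF z] z by (simp add: mult.assoc)
  qed
  then show ?case using C(1) by (intro exI[of _ "- C / q powi i"]) auto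
next
  case (step2 i)
  then obtain C where C: "C \<noteq> 0" "\<And>z. z \<noteq> 0 \<Longrightarrow> qtheta q (q powi i * z) = C * z powi (- i) * qtheta q z"
    by blast
  have "qtheta q (q powi (i - 1) * z) = (- C * q powi (i - 1)) * z powi (- (i - 1)) * qtheta q z"
    if z: "z \<noteq> 0" for z
  proof -
    have "q * (q powi (i - 1) * z) = q powi i * z" by (simp add: power_int_diff)
    moreover have "z powi (- (i - 1)) = z powi (- i) * z"
      using z power_int_add[of z "- i" 1] by (simp add: algebra_simps)
    moreover have "qtheta q y = - y * qtheta q (q * y)" if "y \<noteq> 0" for y
      using qtheta_shift[OF that] that by simp
    from this[of "q powi (i - 1) * z"]
    have "qtheta q (q powi (i - 1) * z) =
        - (q powi (i - 1) * z) * qtheta q (q * (q powi (i - 1) * z))"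
      using z by simp
    ultimately show ?thesis
      using C(2)[OF z] by (simp only:) (simp add: mult_ac)
  qed
  then show ?case using C(1) by (intro exI[of _ "- C * q powi (i - 1)"]) auto
qed

lemma qtheta_eq_0_iff:
  assumes "z \<noteq> 0"
  shows "qtheta q z = 0 \<longleftrightarrow> (\<exists>n::int. z = q powi n)"
proof
  assume "qtheta q z = 0"
  then consider n where "q ^ n * z = 1" | n where "q ^ n * (q / z) = 1"
    by (auto simp: qtheta_def qprod_eq_0_iff)
  then show "\<exists>n::int. z = q powi n"
  proof cases
    case 1
    then have "z = q powi (- int n)"
      by (simp add: power_int_minus field_simps)
    then show ?thesis ..
  next
    case 2
    then have "z = q powi (int (Suc n))"
      using assms by (simp add: field_simps del: of_nat_Suc)
    then show ?thesis ..
  qed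
next
  assume "\<exists>n::int. z = q powi n"
  then obtain n :: int where n: "z = q powi n" ..
  show "qtheta q z = 0"
  proof (cases "n \<le> 0")
    case True
    then obtain k where "n = - int k" by (metis nonpos_int_cases)
    then have "q ^ k * z = 1" using n by (simp add: power_int_minus)
    then show ?thesis by (auto simp: qtheta_def qprod_eq_0_iff)
  next
    case False
    then obtain k where "n = int (Suc k)"
      by (metis nonpos_int_cases not_le pos_int_cases zero_less_imp_eq_int gr0_implies_Suc)
    then have "q ^ k * (q / z) = 1" using n assms by (simp del: of_nat_Suc)
    then show ?thesis by (auto simp: qtheta_def qprod_eq_0_iff)
  qed
qed

lemma qtheta_divide_eq_0_iff:
  assumes "a \<noteq> 0" "b \<noteq> 0"
  shows "qtheta q (a / b) = 0 \<longleftrightarrow> qequiv q a b"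
  using assms by (simp add: qtheta_eq_0_iff qequiv_def)

section \<open>Congruence modulo powers of q, and functions of degree n\<close>

lemma qequiv_sym: "qequiv q a b \<Longrightarrow> qequiv q b a"
  unfolding qequiv_def by (metis inverse_divide power_int_minus)

lemma qequiv_trans:
  assumes "qequiv q a b" "qequiv q b c" "b \<noteq> 0"
  shows "qequiv q a c"
proof -
  obtain m n :: int where "a / b = q powi m" "b / c = q powi n"
    using assms by (auto simp: qequiv_def)
  moreover have "a / c = (a / b) * (b / c)"
    using assms(3) by simp
  ultimately have "a / c = q powi (m + n)"
    by (simp add: power_int_add)
  then show ?thesis by (auto simp: qequiv_def)
qed

lemma qequiv_cross:
  assumes "a / b = c / d"
  shows "qequiv q a b \<longleftrightarrow> qequiv q c d"
  using assms by (simp add: qequiv_def)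

text \<open>Sections of a line bundle of degree \<open>n\<close> on the elliptic curve C^*/q^Z. The
  degree is variable because dividing by a theta factor lowers it by one, and the value at 0 is left
  free because theta quotients are not normalized there.\<close>

definition qspace :: "nat \<Rightarrow> complex \<Rightarrow> (complex \<Rightarrow> complex) set" where
  "qspace n c = {m. m holomorphic_on - {0} \<and> (\<forall>z. z \<noteq> 0 \<longrightarrow> m (q * z) = c / z ^ n * m z)}"

lemma qspaceD:
  assumes "m \<in> qspace n c"
  shows "m holomorphic_on - {0}" "z \<noteq> 0 \<Longrightarrow> m (q * z) = c / z ^ n * m z"
  using assms by (auto simp: qspace_def)

lemma theta_space_eq: "theta_space q c = {m \<in> qspace 2 c. m 0 = 0}"
  by (auto simp: theta_space_def qspace_def)

lemma qspace_lincomb: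
  assumes "f \<in> qspace n c" "g \<in> qspace n c"
  shows "(\<lambda>z. \<alpha> * f z + \<beta> * g z) \<in> qspace n c"
  using assms
  by (auto simp: qspace_def algebra_simps add_divide_distrib intro!: holomorphic_intros)

lemma qspace_mult:
  assumes "f \<in> qspace n c" "g \<in> qspace k d"
  shows "(\<lambda>z. f z * g z) \<in> qspace (n + k) (c * d)"
  using assms by (auto simp: qspace_def power_add intro!: holomorphic_intros)

lemma qtheta_in_qspace:
  assumes "a \<noteq> 0"
  shows "(\<lambda>z. qtheta q (z / a)) \<in> qspace 1 (- a)"
  using qtheta_scaled_holomorphic[of "1 / a"] qtheta_shift[of "_ / a"] assms
  by (auto simp: qspace_def)

lemma qtheta2_in_qspace:
  assumes "a \<noteq> 0" "c \<noteq> 0"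
  shows "(\<lambda>z. qtheta q (z / a) * qtheta q (z * a / c)) \<in> qspace 2 c"
  using qspace_mult[OF qtheta_in_qspace[of a] qtheta_in_qspace[of "c / a"]] assms
  by (simp add: one_add_one del: One_nat_def)

text \<open>Holomorphic functions on the connected punctured plane form an integral domain:
  \<open>G\<close> vanishes on the nonempty open set where \<open>F\<close> does not. This allows
  theta factors to be cancelled even at their zeros.\<close>

lemma holomorphic_prod_eq_0:
  assumes "F holomorphic_on - {0}" "G holomorphic_on - {0}"
    and "\<And>z. z \<noteq> 0 \<Longrightarrow> F z * G z = 0" "F w \<noteq> 0" "w \<noteq> 0" "z \<noteq> (0::complex)"
  shows "G z = 0"
proof -
  have "continuous_on (- {0}) F" using assms by (simp add: holomorphic_on_imp_continuous_on)
  then have op: "open {z \<in> - {0}. F z \<noteq> 0}"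
    using continuous_open_preimage[of "- {0}" F "- {0}"]
    by (auto simp: vimage_def Int_def open_Compl)
  show ?thesis
  proof (rule analytic_continuation_open[OF op, where f = G and g = "\<lambda>_. 0"])
    show "connected (- {0 :: complex})"
      by (rule connected_punctured_universe) simp
  qed (use assms in \<open>auto simp: open_Compl\<close>)
qed

text \<open>The recursion splits \<open>1 - z\<close> off the first product; at 1 the cofactor is
  minus the square of (q; q)_infinity, which is nonzero as |q| < 1.\<close>

lemma qtheta_simple_zero:
  obtains \<psi> U where "open U" "1 \<in> U" "0 \<notin> U" "\<psi> holomorphic_on U" "\<And>z. z \<in> U \<Longrightarrow> \<psi> z \<noteq> 0"
    "\<And>z. z \<in> U \<Longrightarrow> qtheta q z = (z - 1) * \<psi> z"
proof -
  define \<psi> where "\<psi> z = - (qprod q (q * z) * qprod q (q / z))" for z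
  have *: "(\<lambda>z. qprod q (q * z)) holomorphic_on - {0}"
    using holomorphic_on_compose_gen[of "\<lambda>z. q * z" "- {0}" "qprod q" UNIV]
    by (auto simp: o_def qprod_holomorphic intro!: holomorphic_intros)
  have "(\<lambda>z. qprod q (q / z)) holomorphic_on - {0}"
    by (rule qprod_inverse_holomorphic)
  with * have hol: "\<psi> holomorphic_on - {0}"
    unfolding \<psi>_def [abs_def] by (intro holomorphic_intros)
  define U where "U = {z \<in> - {0}. \<psi> z \<noteq> 0}"
  have "continuous_on (- {0}) \<psi>" using hol by (rule holomorphic_on_imp_continuous_on)
  then have "open U"
    using continuous_open_preimage[of "- {0}" \<psi> "- {0}"]
    by (auto simp: U_def vimage_def Int_def open_Compl)
  moreover have "q ^ n * q \<noteq> 1" for n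
  proof -
    have "norm (q ^ Suc n) < 1" using norm_q by (simp add: norm_power power_Suc_less_one del: power_Suc)
    then show ?thesis by (auto simp: mult.commute)
  qed
  then have "1 \<in> U" by (simp add: U_def \<psi>_def qprod_eq_0_iff)
  moreover have eq: "qtheta q z = (z - 1) * \<psi> z" for z
    unfolding qtheta_def \<psi>_def by (subst qprod_rec[of z]) (simp add: algebra_simps)
  moreover have "\<psi> holomorphic_on U"
    by (rule holomorphic_on_subset[OF hol]) (simp add: U_def)
  ultimately show ?thesis
    by (intro that[of U \<psi>]) (simp_all only: U_def, simp_all)
qed

text \<open>The zeros are countable and the plane is not. The point obtained is where a theta factor
  is known to be nonzero before it is cancelled.\<close>

lemma ex_qtheta_nonzero:
  assumes "finite A" "0 \<notin> A"
  obtains w where "w \<noteq> 0" "\<And>a. a \<in> A \<Longrightarrow> qtheta q (w / a) \<noteq> 0"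
proof -
  have "countable ({0} \<union> (\<Union>a\<in>A. range (\<lambda>n::int. q powi n * a)))"
    using assms by (auto simp: countable_finite)
  then obtain w where w: "w \<notin> {0} \<union> (\<Union>a\<in>A. range (\<lambda>n::int. q powi n * a))"
    using uncountable_UNIV_complex by (metis UNIV_eq_I)
  show ?thesis
  proof (rule that)
    show "w \<noteq> 0" using w by simp
    fix a assume a: "a \<in> A"
    then have "a \<noteq> 0" using assms by auto
    show "qtheta q (w / a) \<noteq> 0"
    proof
      assume "qtheta q (w / a) = 0"
      then obtain n :: int where "w / a = q powi n"
        using \<open>a \<noteq> 0\<close> \<open>w \<noteq> 0\<close> by (auto simp: qtheta_eq_0_iff)
      then have "w = q powi n * a" using \<open>a \<noteq> 0\<close> by (simp add: field_simps)
      with w a show False by blast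
    qed
  qed
qed

section \<open>Division by theta factors and the position of zeros\<close>

lemma qspace_shift_int:
  assumes "m \<in> qspace n c" "c \<noteq> 0" "z \<noteq> 0" "m z = 0"
  shows "m (q powi k * z) = 0"
proof -
  have nz: "q powi i * z \<noteq> 0" for i using assms by simp
  have eq: "m (q powi (i + 1) * z) = 0 \<longleftrightarrow> m (q powi i * z) = 0" for i
    using qspaceD(2)[OF assms(1) nz[of i]] assms nz[of i] by (simp add: power_int_add mult_ac)
  show ?thesis
  proof (induction k rule: int_induct[where k = 0])
    case base then show ?case using assms by simp
  next
    case (step1 i) then show ?case using eq[of i] by simp
  next
    case (step2 i) then show ?case using eq[of "i - 1"] by simp
  qed
qed

text \<open>The zeros of \<open>m\<close> are invariant under q^Z, so \<open>m\<close> vanishes at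
  all zeros of the theta factor; these are simple, hence the quotient is holomorphic. Its multiplier
  is that of \<open>m\<close> divided by that of the theta factor, \<open>c / (- a)\<close>.\<close>

lemma qspace_divide:
  assumes m: "m \<in> qspace (Suc n) c" and a: "a \<noteq> 0" "m a = 0" and c: "c \<noteq> 0"
  obtains m' where "m' \<in> qspace n (- c / a)" "\<And>z. z \<noteq> 0 \<Longrightarrow> m z = qtheta q (z / a) * m' z"
proof -
  let ?t = "\<lambda>z. qtheta q (z / a)"
  note hm = qspaceD(1)[OF m]
  have ht: "?t holomorphic_on - {0}" using qspaceD(1)[OF qtheta_in_qspace[OF a(1)]] .
  \<comment> \<open>At a zero of the theta factor the value is the one given by l'Hospital's
    rule.\<close>
  define m' where "m' z = (if ?t z = 0 then deriv m z / deriv ?t z else m z / ?t z)" for z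
  have mz: "m w = 0" if w: "w \<noteq> 0" "?t w = 0" for w
  proof -
    obtain k where "w / a = q powi k"
      using w a by (auto simp: qtheta_eq_0_iff)
    then have "w = q powi k * a" using a by (simp add: field_simps)
    then show ?thesis using qspace_shift_int[OF m c a] by simp
  qed
  \<comment> \<open>Near \<open>w\<close>, congruent to \<open>a\<close>, the factor is
    \<open>z - w\<close> times a unit; this is the factorization at 1, transported by the shift
    \<open>q powi k\<close>.\<close>
  have loc: "\<exists>\<psi> U. open U \<and> w \<in> U \<and> 0 \<notin> U \<and> \<psi> holomorphic_on U \<and> (\<forall>z\<in>U. \<psi> z \<noteq> 0) \<and>
      (\<forall>z\<in>U. ?t z = (z - w) * \<psi> z)" if w: "w \<noteq> 0" "?t w = 0" for w
  proof -
    obtain k where k: "w / a = q powi k"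
      using w a by (auto simp: qtheta_eq_0_iff)
    obtain C where C: "C \<noteq> 0" "\<And>z. z \<noteq> 0 \<Longrightarrow> qtheta q (q powi k * z) = C * z powi (- k) * qtheta q z"
      using qtheta_shift_int[of k] by blast
    obtain \<psi> U where U: "open U" "1 \<in> U" "0 \<notin> U" "\<psi> holomorphic_on U" "\<And>z. z \<in> U \<Longrightarrow> \<psi> z \<noteq> 0"
      "\<And>z. z \<in> U \<Longrightarrow> qtheta q z = (z - 1) * \<psi> z" using qtheta_simple_zero by metis
    define V where "V = (\<lambda>z. z / w) -` U"
    define \<phi> where "\<phi> z = C / w * (z / w) powi (- k) * \<psi> (z / w)" for z
    have V: "open V" "w \<in> V" "0 \<notin> V"
      using U w unfolding V_def by (auto intro!: open_vimage continuous_intros)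
    have hw: "(\<lambda>z. z / w) holomorphic_on V"
      using w by (intro holomorphic_intros) auto
    from holomorphic_on_compose_gen[OF this U(4)]
    have "(\<lambda>z. \<psi> (z / w)) holomorphic_on V" by (auto simp: o_def V_def)
    then have "\<phi> holomorphic_on V"
      unfolding \<phi>_def [abs_def] using hw w V by (intro holomorphic_intros) auto
    moreover have "\<phi> z \<noteq> 0" if "z \<in> V" for z
      using that U(5)[of "z / w"] w C V by (auto simp: \<phi>_def V_def)
    moreover have "?t z = (z - w) * \<phi> z" if "z \<in> V" for z
    proof -
      have z: "z / w \<noteq> 0" using that V w by auto
      have "z / a = q powi k * (z / w)" using k a w by (simp add: field_simps)
      then have "?t z = C * (z / w) powi (- k) * ((z / w - 1) * \<psi> (z / w))"
        using C(2)[OF z] U(6)[of "z / w"] that by (simp add: V_def)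
      then show ?thesis using w by (simp add: \<phi>_def field_simps)
    qed
    ultimately show ?thesis using V by blast
  qed
  have hm': "m' holomorphic_on - {0}"
  proof -
    have "\<exists>U. open U \<and> w \<in> U \<and> m' holomorphic_on U" if "w \<noteq> 0" for w
    proof (cases "?t w = 0")
      case False
      have "continuous_on (- {0}) ?t" using ht by (rule holomorphic_on_imp_continuous_on)
      then have op: "open {z \<in> - {0}. ?t z \<noteq> 0}" (is "open ?U")
        using continuous_open_preimage[of "- {0}" ?t "- {0}"]
        by (auto simp: vimage_def Int_def open_Compl)
      have "(\<lambda>z. m z / ?t z) holomorphic_on ?U"
        by (intro holomorphic_intros holomorphic_on_subset[OF hm] holomorphic_on_subset[OF ht]) auto
      then have "m' holomorphic_on ?U"
        by (rule holomorphic_transform) (auto simp: m'_def)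
      then show ?thesis using op False that by (intro exI[of _ ?U]) auto
    next
      case True
      from loc[OF that True] obtain \<psi> U where U: "open U" "w \<in> U" "0 \<notin> U" "\<psi> holomorphic_on U"
        "\<And>z. z \<in> U \<Longrightarrow> \<psi> z \<noteq> 0" "\<And>z. z \<in> U \<Longrightarrow> ?t z = (z - w) * \<psi> z" by metis
      have mU: "m holomorphic_on U" using U by (intro holomorphic_on_subset[OF hm]) auto
      from pole_lemma_open[OF mU U(1), of w]
      have p: "(\<lambda>z. if z = w then deriv m w else m z / (z - w)) holomorphic_on U"
        unfolding mz[OF that True] diff_zero .
      have d: "deriv ?t w = \<psi> w"
      proof -
        have "(\<psi> has_field_derivative deriv \<psi> w) (at w)"
          using U by (simp add: holomorphic_derivI)
        then have "((\<lambda>z. (z - w) * \<psi> z) has_field_derivative \<psi> w) (at w)"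
          by (auto intro!: derivative_eq_intros)
        then have "(?t has_field_derivative \<psi> w) (at w)"
          by (rule has_field_derivative_transform_within_open[OF _ U(1,2)]) (simp add: U(6))
        then show ?thesis by (rule DERIV_imp_deriv)
      qed
      have "(\<lambda>z. (if z = w then deriv m w else m z / (z - w)) / \<psi> z) holomorphic_on U"
        using p U(4,5) by (intro holomorphic_intros)
      then have "m' holomorphic_on U"
        by (rule holomorphic_transform) (use U(5,6) True d in \<open>auto simp: m'_def\<close>)
      then show ?thesis using U by blast
    qed
    then show ?thesis
      by (metis ComplD holomorphic_on_def holomorphic_on_imp_differentiable_at insertI1
          field_differentiable_at_within)
  qed
  have eq: "m z = ?t z * m' z" if "z \<noteq> 0" for z
    using mz[OF that] by (auto simp: m'_def)
  have "m' (q * z) = (- c / a) / z ^ n * m' z" if "z \<noteq> 0" for z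
  proof -
    obtain w where w: "w \<noteq> 0" "?t w \<noteq> 0"
      using ex_qtheta_nonzero[of "{a}"] a by auto
    have hs: "(\<lambda>z. m' (q * z)) holomorphic_on - {0}"
    proof -
      have "(\<lambda>z. q * z) holomorphic_on - {0}" by (intro holomorphic_intros)
      moreover have "(\<lambda>z. q * z) ` (- {0}) \<subseteq> - {0}" by auto
      ultimately show ?thesis using holomorphic_on_compose_gen[OF _ hm'] by (simp add: o_def)
    qed
    \<comment> \<open>The functional equations of \<open>m\<close> and of the theta factor give this
      identity after multiplication by the theta factor, which is then cancelled on the whole
      punctured plane.\<close>
    have "m' (q * z) - (- c / a) / z ^ n * m' z = 0"
    proof (rule holomorphic_prod_eq_0[OF ht _ _ w(2,1) that])
      show "(\<lambda>z. m' (q * z) - (- c / a) / z ^ n * m' z) holomorphic_on - {0}"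
        using hs hm' by (intro holomorphic_intros) auto
      fix z :: complex assume z: "z \<noteq> 0"
      have "- (a / z) * (?t z * m' (q * z)) = ?t (q * z) * m' (q * z)"
        using qspaceD(2)[OF qtheta_in_qspace[OF a(1)] z] z by simp
      also have "\<dots> = c / z ^ Suc n * (?t z * m' z)"
        using eq[of "q * z"] eq[OF z] qspaceD(2)[OF m z] z by simp
      finally show "?t z * (m' (q * z) - (- c / a) / z ^ n * m' z) = 0"
        using z a by (simp add: field_simps) (metis add_eq_0_iff minus_minus add.commute)
    qed
    then show ?thesis by (simp add: eq_neg_iff_add_eq_0)
  qed
  with hm' eq show ?thesis using that[of m'] by (auto simp: qspace_def)
qed

text \<open>The n-th Laurent coefficient of \<open>m\<close> is multiplied both by
  \<open>q ^ n\<close> and by \<open>c\<close> under the shift, so it vanishes unless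
  \<open>c\<close> is a power of \<open>q\<close>. To work with Taylor coefficients, a power of
  \<open>z\<close> is multiplied in that makes \<open>m\<close> bounded near 0.\<close>

lemma qspace_0:
  assumes m: "m \<in> qspace 0 c" and c: "c \<noteq> 0" and w: "w \<noteq> 0" "m w \<noteq> 0"
  shows "\<exists>n::int. c = q powi n"
proof (rule ccontr)
  assume nq: "\<nexists>n::int. c = q powi n"
  \<comment> \<open>Multiplication by \<open>z ^ N\<close> changes the multiplier to
    \<open>q ^ N * c\<close>; once this is smaller than 1 in norm, values decrease towards the
    origin.\<close>
  obtain N :: nat where N: "norm (q ^ N * c) < 1"
  proof -
    have "(\<lambda>n. q ^ n * c) \<longlonglongrightarrow> 0"
      using LIMSEQ_power_zero[OF norm_q] by (intro tendsto_mult_left_zero)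
    then have "\<forall>\<^sub>F n in sequentially. norm (q ^ n * c) < 1"
      using order_tendstoD(2)[OF tendsto_norm_zero, of "\<lambda>n. q ^ n * c" sequentially 1] by simp
    then show ?thesis using that by (auto simp: eventually_sequentially)
  qed
  define \<kappa> where "\<kappa> = q ^ N * c"
  define f where "f z = z ^ N * m z" for z
  have hf: "f holomorphic_on - {0}"
    unfolding f_def [abs_def] using qspaceD(1)[OF m] by (intro holomorphic_intros)
  have f: "f (q * z) = \<kappa> * f z" if "z \<noteq> 0" for z
    using qspaceD(2)[OF m that] by (simp add: f_def \<kappa>_def power_mult_distrib)
  have fn: "f (q ^ k * z) = \<kappa> ^ k * f z" if "z \<noteq> 0" for z k
    by (induction k) (use f[of "q ^ _ * z"] that in \<open>auto simp: mult_ac\<close>)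
  let ?A = "{z :: complex. norm q \<le> norm z \<and> norm z \<le> 1}"
  have "compact ?A"
  proof -
    have "?A = cball 0 1 - ball 0 (norm q)" by auto
    then show ?thesis using compact_diff[OF compact_cball open_ball, of "0 :: complex" 1 0 "norm q"] by simp
  qed
  moreover have "continuous_on ?A f"
    using holomorphic_on_imp_continuous_on[OF hf] by (rule continuous_on_subset) auto
  ultimately have "bounded (f ` ?A)"
    by (intro compact_imp_bounded compact_continuous_image)
  then obtain B where B: "\<And>z. z \<in> ?A \<Longrightarrow> norm (f z) \<le> B"
    by (auto simp: bounded_iff)
  have bd: "norm (f z) \<le> B" if z: "z \<noteq> 0" "norm z \<le> 1" for z
  proof -
    have "\<exists>k. norm q ^ Suc k < norm z"
    proof -
      obtain k where "norm q ^ k < norm z" using z norm_q real_arch_pow_inv[of "norm z" "norm q"] by auto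
      moreover have "norm q ^ Suc k \<le> norm q ^ k" using norm_q by (intro power_decreasing) auto
      ultimately have "norm q ^ Suc k < norm z" by linarith
      then show ?thesis ..
    qed
    \<comment> \<open>The number of shifts that bring \<open>z\<close> back from the small annulus
      to the fundamental annulus \<open>?A\<close>, where compactness gives the bound.\<close>
    define k where "k = (LEAST k. norm q ^ Suc k < norm z)"
    have k: "norm q ^ Suc k < norm z" unfolding k_def by (rule LeastI_ex) fact
    have k': "norm z \<le> norm q ^ k"
    proof (cases k)
      case 0 then show ?thesis using z by simp
    next
      case (Suc j)
      then have "j < (LEAST k. norm q ^ Suc k < norm z)" unfolding k_def by simp
      from not_less_Least[OF this] have "\<not> norm q ^ Suc j < norm z" .
      then show ?thesis using Suc by simp
    qed
    define y where "y = z / q ^ k"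
    have "y \<in> ?A" "y \<noteq> 0" using k k' z by (auto simp: y_def norm_divide norm_power field_simps)
    have "norm (f z) = norm \<kappa> ^ k * norm (f y)"
      using fn[OF \<open>y \<noteq> 0\<close>, of k] by (simp add: y_def norm_mult norm_power)
    also have "\<dots> \<le> 1 * B"
      using B[OF \<open>y \<in> ?A\<close>] N by (intro mult_mono power_le_one) (auto simp: \<kappa>_def)
    finally show ?thesis by simp
  qed
  have "\<exists>B. \<forall>\<^sub>F z in at 0. norm (f z) \<le> B"
    using bd by (intro exI[of _ B]) (auto simp: eventually_at intro!: exI[of _ 1])
  then obtain g where g: "g holomorphic_on UNIV" "\<And>z. z \<noteq> 0 \<Longrightarrow> g z = f z"
    using holomorphic_on_extend_bounded[of f UNIV 0] hf by (auto simp: Compl_eq_Diff_UNIV)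
  have geq: "g (q * z) = \<kappa> * g z" for z
  proof -
    have "g (q * z) - \<kappa> * g z = 0" if "z \<in> UNIV" for z
    proof (rule analytic_continuation[of "\<lambda>z. g (q * z) - \<kappa> * g z" UNIV "- {0}" 0])
      have "(\<lambda>z. q * z) holomorphic_on UNIV" by (intro holomorphic_intros)
      from holomorphic_on_compose_gen[OF this g(1)]
      have "(\<lambda>z. g (q * z)) holomorphic_on UNIV" by (auto simp: o_def)
      then show "(\<lambda>z. g (q * z) - \<kappa> * g z) holomorphic_on UNIV" using g by (intro holomorphic_intros)
      show "(0::complex) islimpt - {0}"
        using islimpt_punctured[of "0::complex" UNIV] islimpt_UNIV[of "0::complex"]
        by (simp add: Compl_eq_Diff_UNIV)
    qed (use g f in auto)
    then show ?thesis by simp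
  qed
  \<comment> \<open>Differentiating \<open>g (q * z) = \<kappa> * g z\<close> at 0 gives the factors
    \<open>q ^ n\<close> and \<open>\<kappa>\<close>, which are distinct since \<open>c\<close> is
    not a power of \<open>q\<close>.\<close>
  have der: "(deriv ^^ n) g 0 = 0" for n
  proof -
    have "(deriv ^^ n) (\<lambda>z. g (q * z)) 0 = q ^ n * (deriv ^^ n) g (q * 0)"
      by (rule higher_deriv_compose_linear[OF g(1) open_UNIV open_UNIV]) auto
    moreover have "(deriv ^^ n) (\<lambda>z. g (q * z)) 0 = \<kappa> * (deriv ^^ n) g 0"
      unfolding geq by (rule higher_deriv_cmult[OF g(1)]) auto
    ultimately have "(q ^ n - \<kappa>) * (deriv ^^ n) g 0 = 0" by (auto simp: left_diff_distrib)
    moreover have "q ^ n \<noteq> \<kappa>"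
    proof
      assume "q ^ n = \<kappa>"
      then have "c = q ^ n / q ^ N" by (simp add: \<kappa>_def)
      then have "c = q powi (int n - int N)" by (simp add: power_int_diff)
      with nq show False by blast
    qed
    ultimately show ?thesis by simp
  qed
  have "g w = 0"
    by (rule holomorphic_fun_eq_0_on_connected[OF g(1) _ _ der]) auto
  with g(2)[OF w(1)] w show False by (simp add: f_def)
qed

text \<open>A nonzero function of degree one with multiplier \<open>- c\<close> vanishes exactly on
  the class of \<open>c\<close>: dividing out another zero \<open>b\<close> leaves degree zero with
  multiplier \<open>c / b\<close>, outside q^Z.\<close>

lemma qspace_1_eq_0:
  assumes m: "m \<in> qspace 1 (- c)" and nz: "c \<noteq> 0" "b \<noteq> 0" and b: "m b = 0" "\<not> qequiv q c b"
    and z: "z \<noteq> 0"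
  shows "m z = 0"
proof -
  have "m \<in> qspace (Suc 0) (- c)" using m by simp
  from qspace_divide[OF this nz(2) b(1)] nz obtain m' where
    m': "m' \<in> qspace 0 (c / b)" "\<And>z. z \<noteq> 0 \<Longrightarrow> m z = qtheta q (z / b) * m' z"
    by auto
  have "m' z = 0"
    using qspace_0[OF m'(1) _ z] b(2) nz by (auto simp: qequiv_def)
  then show ?thesis using m'(2)[OF z] by simp
qed

text \<open>The product of the two zeros of a nonzero function of degree two is congruent to its
  multiplier. This is how non-splitting enters: no nonzero entry can vanish at two of the points
  \<open>x k\<close>.\<close>

lemma qspace_2_eq_0:
  assumes m: "m \<in> qspace 2 c" and nz: "c \<noteq> 0" "a \<noteq> 0" "b \<noteq> 0" and ab: "m a = 0" "m b = 0"
    and ne: "\<not> qequiv q b a" "\<not> qequiv q c (a * b)" and z: "z \<noteq> 0"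
  shows "m z = 0"
proof -
  have "m \<in> qspace (Suc 1) c" using m by (simp add: numeral_2_eq_2)
  from qspace_divide[OF this nz(2) ab(1)] nz obtain m' where
    m': "m' \<in> qspace 1 (- (c / a))" "\<And>z. z \<noteq> 0 \<Longrightarrow> m z = qtheta q (z / a) * m' z"
    by auto
  have "m' b = 0" using m'(2)[OF nz(3)] ab ne nz by (simp add: qtheta_divide_eq_0_iff)
  moreover have "qequiv q (c / a) b \<longleftrightarrow> qequiv q c (a * b)"
    by (rule qequiv_cross) simp
  ultimately have "m' z = 0" using qspace_1_eq_0[OF m'(1) _ nz(3) _ _ z] nz ne(2) by simp
  then show ?thesis using m'(2)[OF z] by simp
qed

text \<open>The multiplier fixes the product of the four zeros, so three zeros determine the fourth:
  dividing them out leaves degree one with multiplier \<open>- a4\<close>, and such functions are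
  multiples of the theta function vanishing at \<open>a4\<close>.\<close>

lemma qspace_4_factor:
  assumes m: "m \<in> qspace 4 (a1 * a2 * a3 * a4)"
    and nz: "a1 \<noteq> 0" "a2 \<noteq> 0" "a3 \<noteq> 0" "a4 \<noteq> 0" and zeros: "m a1 = 0" "m a2 = 0" "m a3 = 0"
    and ne: "\<not> qequiv q a2 a1" "\<not> qequiv q a3 a1" "\<not> qequiv q a3 a2"
  shows "\<exists>K. \<forall>z. z \<noteq> 0 \<longrightarrow>
    m z = K * (qtheta q (z / a1) * qtheta q (z / a2) * qtheta q (z / a3) * qtheta q (z / a4))"
proof -
  have "m \<in> qspace (Suc 3) (a1 * a2 * a3 * a4)" using m by (simp add: eval_nat_numeral)
  from qspace_divide[OF this nz(1) zeros(1)] nz obtain m1 where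
    m1: "m1 \<in> qspace (Suc 2) (- (a2 * a3 * a4))" "\<And>z. z \<noteq> 0 \<Longrightarrow> m z = qtheta q (z / a1) * m1 z"
    by (auto simp: eval_nat_numeral mult_ac)
  have "m1 a2 = 0" using m1(2)[OF nz(2)] zeros ne nz by (simp add: qtheta_divide_eq_0_iff)
  from qspace_divide[OF m1(1) nz(2) this] nz obtain m2 where
    m2: "m2 \<in> qspace (Suc 1) (a3 * a4)" "\<And>z. z \<noteq> 0 \<Longrightarrow> m1 z = qtheta q (z / a2) * m2 z"
    by (auto simp: eval_nat_numeral mult_ac)
  have "m2 a3 = 0" using m1(2)[OF nz(3)] m2(2)[OF nz(3)] zeros ne nz
    by (simp add: qtheta_divide_eq_0_iff)
  from qspace_divide[OF m2(1) nz(3) this] nz obtain m3 where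
    m3: "m3 \<in> qspace 1 (- a4)" "\<And>z. z \<noteq> 0 \<Longrightarrow> m2 z = qtheta q (z / a3) * m3 z"
    by (auto simp: mult_ac)
  \<comment> \<open>A point incongruent to \<open>a4\<close>, at which \<open>K\<close> is chosen so
    that the difference acquires a forbidden zero.\<close>
  obtain b where b: "b \<noteq> 0" "qtheta q (b / a4) \<noteq> 0"
    using ex_qtheta_nonzero[of "{a4}"] nz by auto
  define K where "K = m3 b / qtheta q (b / a4)"
  have "m3 z = K * qtheta q (z / a4)" if "z \<noteq> 0" for z
  proof -
    have "1 * m3 z + (- K) * qtheta q (z / a4) = 0"
    proof (rule qspace_1_eq_0[OF _ nz(4) b(1) _ _ that])
      show "(\<lambda>z. 1 * m3 z + (- K) * qtheta q (z / a4)) \<in> qspace 1 (- a4)"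
        by (intro qspace_lincomb m3 qtheta_in_qspace nz)
      show "\<not> qequiv q a4 b" using b nz qequiv_sym by (auto simp: qtheta_divide_eq_0_iff)
    qed (use b in \<open>simp add: K_def\<close>)
    then show ?thesis by simp
  qed
  then show ?thesis using m1(2) m2(2) m3(2) by (intro exI[of _ K]) (simp add: mult_ac)
qed

text \<open>The function of degree two and multiplier \<open>c\<close> with a zero at
  \<open>a\<close>; its second zero is \<open>c / a\<close>.\<close>

definition qbase :: "complex \<Rightarrow> complex \<Rightarrow> complex \<Rightarrow> complex" where
  "qbase c a z = qtheta q (z / a) * qtheta q (z * a / c)"

lemma qbase_in_qspace: "a \<noteq> 0 \<Longrightarrow> c \<noteq> 0 \<Longrightarrow> qbase c a \<in> qspace 2 c"
  unfolding qbase_def [abs_def] by (rule qtheta2_in_qspace)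

lemma qbase_eq_0_iff:
  assumes "a \<noteq> 0" "c \<noteq> 0" "z \<noteq> 0"
  shows "qbase c a z = 0 \<longleftrightarrow> qequiv q z a \<or> qequiv q (z * a) c"
  using assms by (simp add: qbase_def qtheta_divide_eq_0_iff)

lemma qtheta_1 [simp]: "qtheta q 1 = 0"
  using qtheta_eq_0_iff[of 1] by (metis one_neq_zero power_int_0_right)

lemma qbase_self [simp]: "a \<noteq> 0 \<Longrightarrow> qbase c a a = 0"
  by (simp add: qbase_def)

text \<open>The difference of \<open>m\<close> and \<open>\<beta> * qbase c a\<close> vanishes at
  \<open>a\<close>, and at \<open>b\<close> by the choice of \<beta>.\<close>

lemma qspace_2_multiple:
  assumes m: "m \<in> qspace 2 c" "m a = 0" and nz: "c \<noteq> 0" "a \<noteq> 0" "b \<noteq> 0"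
    and ne: "\<not> qequiv q b a" "\<not> qequiv q c (a * b)"
  obtains \<beta> where "\<And>z. z \<noteq> 0 \<Longrightarrow> m z = \<beta> * qbase c a z"
proof -
  have nzb: "qbase c a b \<noteq> 0"
    using ne nz qequiv_sym[of "b * a" c] by (auto simp: qbase_eq_0_iff mult.commute)
  define \<beta> where "\<beta> = m b / qbase c a b"
  have "1 * m z + (- \<beta>) * qbase c a z = 0" if "z \<noteq> 0" for z
    by (rule qspace_2_eq_0[OF qspace_lincomb nz _ _ ne that])
       (use m nz nzb in \<open>simp_all add: \<beta>_def qbase_in_qspace\<close>)
  then show ?thesis using that[of \<beta>] by simp
qed

lemma qequiv_cancel: "z \<noteq> 0 \<Longrightarrow> qequiv q (a * z) (b * z) \<longleftrightarrow> qequiv q a b"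
  by (rule qequiv_cross) simp

end

section \<open>The pencil of matrices with a prescribed row or column\<close>

text \<open>
  The numbers \<open>c a\<close> and \<open>d a\<close> are the multipliers of the entries of two parallel columns or two
  parallel rows. The first of the two, \<open>f\<close>, vanishes at \<open>y 0\<close>, and \<open>s\<close>, \<open>t\<close> are the ratios of the second
  one, \<open>g\<close>, to \<open>f\<close> at \<open>y 1\<close> and \<open>y 2\<close>.
\<close>

locale pencil = nome +
  fixes y :: "nat \<Rightarrow> complex" and c d :: "2 \<Rightarrow> complex"
  assumes y_nonzero: "i < 4 \<Longrightarrow> y i \<noteq> 0"
    and y_distinct: "i < 4 \<Longrightarrow> j < 4 \<Longrightarrow> i \<noteq> j \<Longrightarrow> \<not> qequiv q (y i) (y j)"
    and c_nonzero: "c a \<noteq> 0" and d_nonzero: "d a \<noteq> 0"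
    and c_generic: "i < 4 \<Longrightarrow> j < 4 \<Longrightarrow> i \<noteq> j \<Longrightarrow> \<not> qequiv q (c a) (y i * y j)"
    and d_generic: "i < 4 \<Longrightarrow> j < 4 \<Longrightarrow> i \<noteq> j \<Longrightarrow> \<not> qequiv q (d a) (y i * y j)"
    and prod_y: "y 0 * y 1 * y 2 * y 3 = c 1 * d 2" and prod_cd: "c 1 * d 2 = c 2 * d 1"
    and c12: "\<not> qequiv q (c 1) (c 2)" and cd: "\<not> qequiv q (c a) (d a)"
begin

declare One_nat_def [simp del]

definition f :: "2 \<Rightarrow> complex \<Rightarrow> complex" where
  "f a = qbase (c a) (y 0)"

text \<open>Lagrange interpolation with nodes \<open>y 1\<close> and \<open>y 2\<close>: each
  \<open>qbase\<close> term vanishes at one node and is normalized at the other.\<close>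

definition g :: "2 \<Rightarrow> complex \<Rightarrow> complex \<Rightarrow> complex \<Rightarrow> complex" where
  "g a s t z =
     s * f a (y 1) * qbase (d a) (y 2) z / qbase (d a) (y 2) (y 1)
     + t * f a (y 2) * qbase (d a) (y 1) z / qbase (d a) (y 1) (y 2)"

text \<open>Its multiplier is the product of the numbers \<open>- y i\<close>, which
  \<open>prod_y\<close> identifies with \<open>c 1 * d 2\<close>, the multiplier of the
  determinant.\<close>

definition \<Theta> :: "complex \<Rightarrow> complex" where
  "\<Theta> z = qtheta q (z / y 0) * qtheta q (z / y 1) * qtheta q (z / y 2) * qtheta q (z / y 3)"

lemma qbase_c_nonzero:
  "i < 4 \<Longrightarrow> j < 4 \<Longrightarrow> i \<noteq> j \<Longrightarrow> qbase (c a) (y i) (y j) \<noteq> 0"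
  using y_nonzero c_nonzero y_distinct c_generic[of i j a] qequiv_sym[of "y i * y j" "c a"]
  by (auto simp: qbase_eq_0_iff mult.commute)

lemma qbase_d_nonzero:
  "i < 4 \<Longrightarrow> j < 4 \<Longrightarrow> i \<noteq> j \<Longrightarrow> qbase (d a) (y i) (y j) \<noteq> 0"
  using y_nonzero d_nonzero y_distinct d_generic[of i j a] qequiv_sym[of "y i * y j" "d a"]
  by (auto simp: qbase_eq_0_iff mult.commute)

lemma f_in_qspace: "f a \<in> qspace 2 (c a)"
  unfolding f_def using y_nonzero c_nonzero by (intro qbase_in_qspace) auto

lemma f_0: "f a (y 0) = 0"
  unfolding f_def using y_nonzero by simp

lemma f_nonzero: "0 < i \<Longrightarrow> i < 4 \<Longrightarrow> f a (y i) \<noteq> 0"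
  unfolding f_def by (intro qbase_c_nonzero) auto

lemma g_in_qspace: "g a s t \<in> qspace 2 (d a)"
proof -
  have "(\<lambda>z. (s * f a (y 1) / qbase (d a) (y 2) (y 1)) * qbase (d a) (y 2) z
      + (t * f a (y 2) / qbase (d a) (y 1) (y 2)) * qbase (d a) (y 1) z) \<in> qspace 2 (d a)"
    using y_nonzero d_nonzero by (intro qspace_lincomb qbase_in_qspace) auto
  then show ?thesis by (simp add: g_def [abs_def])
qed

lemma g_1: "g a s t (y 1) = s * f a (y 1)"
  using qbase_d_nonzero[of 2 1 a] y_nonzero by (simp add: g_def)

lemma g_2: "g a s t (y 2) = t * f a (y 2)"
  using qbase_d_nonzero[of 1 2 a] y_nonzero by (simp add: g_def)

lemma g_linear: "g a s t z = s * g a 1 0 z + t * g a 0 1 z"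
  by (simp add: g_def mult.assoc)

lemma g_unique:
  assumes h: "h \<in> qspace 2 (d a)" and z: "z \<noteq> 0"
  shows "h z = g a (h (y 1) / f a (y 1)) (h (y 2) / f a (y 2)) z"
proof -
  let ?s = "h (y 1) / f a (y 1)" and ?t = "h (y 2) / f a (y 2)"
  have "1 * h z + (- 1) * g a ?s ?t z = 0"
  proof (rule qspace_2_eq_0[of "\<lambda>z. 1 * h z + (- 1) * g a ?s ?t z" "d a" "y 1" "y 2"])
    show "(\<lambda>z. 1 * h z + (- 1) * g a ?s ?t z) \<in> qspace 2 (d a)"
      by (intro qspace_lincomb h g_in_qspace)
  qed (use z y_nonzero d_nonzero y_distinct d_generic f_nonzero in \<open>simp_all add: g_1 g_2\<close>)
  then show ?thesis by simp
qed

section \<open>The determinant of the pencil\<close>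

lemma det_in_qspace:
  assumes "F 1 \<in> qspace 2 (c 1)" "F 2 \<in> qspace 2 (c 2)" "G 1 \<in> qspace 2 (d 1)" "G 2 \<in> qspace 2 (d 2)"
  shows "(\<lambda>z. F 1 z * G 2 z - F 2 z * G 1 z) \<in> qspace 4 (c 1 * d 2)"
proof -
  have "(\<lambda>z. F 1 z * G 2 z) \<in> qspace (2 + 2) (c 1 * d 2)"
    using assms by (intro qspace_mult)
  moreover have "(\<lambda>z. F 2 z * G 1 z) \<in> qspace (2 + 2) (c 2 * d 1)"
    using assms by (intro qspace_mult)
  ultimately have "(\<lambda>z. 1 * (F 1 z * G 2 z) + (- 1) * (F 2 z * G 1 z)) \<in> qspace 4 (c 1 * d 2)"
    unfolding prod_cd by (intro qspace_lincomb) auto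
  then show ?thesis by simp
qed

lemma det_multiple:
  assumes "F 1 \<in> qspace 2 (c 1)" "F 2 \<in> qspace 2 (c 2)" "G 1 \<in> qspace 2 (d 1)" "G 2 \<in> qspace 2 (d 2)"
    and "\<And>i. i < 3 \<Longrightarrow> F 1 (y i) * G 2 (y i) - F 2 (y i) * G 1 (y i) = 0"
  shows "\<exists>K. \<forall>z. z \<noteq> 0 \<longrightarrow> F 1 z * G 2 z - F 2 z * G 1 z = K * \<Theta> z"
  unfolding \<Theta>_def
  by (rule qspace_4_factor[of "\<lambda>z. F 1 z * G 2 z - F 2 z * G 1 z"])
     (use assms(5)[of 0] assms(5)[of 1] assms(5)[of 2] y_nonzero y_distinct
       det_in_qspace[OF assms(1-4)] prod_y in auto)

lemma \<Theta>_nonzero: obtains w where "w \<noteq> 0" "\<Theta> w \<noteq> 0"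
proof -
  obtain w where "w \<noteq> 0" "\<And>a. a \<in> {y 0, y 1, y 2, y 3} \<Longrightarrow> qtheta q (w / a) \<noteq> 0"
    by (rule ex_qtheta_nonzero[of "{y 0, y 1, y 2, y 3}"]) (use y_nonzero in auto)
  then show ?thesis using that[of w] by (simp add: \<Theta>_def)
qed

definition \<delta> :: "complex \<Rightarrow> complex \<Rightarrow> complex" where
  "\<delta> s t = (SOME K. \<forall>z. z \<noteq> 0 \<longrightarrow> f 1 z * g 2 s t z - f 2 z * g 1 s t z = K * \<Theta> z)"

lemma det_f_g:
  assumes "z \<noteq> 0"
  shows "f 1 z * g 2 s t z - f 2 z * g 1 s t z = \<delta> s t * \<Theta> z"
proof -
  have *: "f 1 (y i) * g 2 s t (y i) - f 2 (y i) * g 1 s t (y i) = 0" if "i < 3" for i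
  proof -
    have "i = 0 \<or> i = 1 \<or> i = 2" using that by auto
    then show ?thesis by (auto simp: f_0 g_1 g_2)
  qed
  have "\<exists>K. \<forall>z. z \<noteq> 0 \<longrightarrow> f 1 z * g 2 s t z - f 2 z * g 1 s t z = K * \<Theta> z"
    by (rule det_multiple[of f "\<lambda>a. g a s t"]) (use * in \<open>auto intro: f_in_qspace g_in_qspace\<close>)
  from someI_ex[OF this] assms show ?thesis unfolding \<delta>_def by blast
qed

lemma \<delta>_linear: "\<delta> s t = s * \<delta> 1 0 + t * \<delta> 0 1"
proof -
  obtain w where w: "w \<noteq> 0" "\<Theta> w \<noteq> 0" by (rule \<Theta>_nonzero)
  have "\<delta> s t * \<Theta> w = s * (\<delta> 1 0 * \<Theta> w) + t * (\<delta> 0 1 * \<Theta> w)"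
    unfolding det_f_g[OF w(1), symmetric] by (subst (1 2) g_linear) (simp add: algebra_simps)
  then have "(\<delta> s t - (s * \<delta> 1 0 + t * \<delta> 0 1)) * \<Theta> w = 0" by (simp add: algebra_simps)
  then show ?thesis using w(2) by simp
qed

text \<open>The determinant vanishes at \<open>y 3\<close> because \<Theta> does, so both entries
  have the same ratio there, which is expressed by the entries with index 1.\<close>

lemma g_3:
  "g a s t (y 3) = g 1 s t (y 3) / f 1 (y 3) * f a (y 3)"
proof -
  have "f 1 (y 3) * g 2 s t (y 3) = f 2 (y 3) * g 1 s t (y 3)"
    using det_f_g[of "y 3" s t] y_nonzero[of 3] by (simp add: \<Theta>_def)
  moreover have "a = 1 \<or> a = 2" by (rule exhaust_2)
  ultimately show ?thesis using f_nonzero[of 3] by (auto simp: field_simps)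
qed

text \<open>
  When all four entries vanish at \<open>y 0\<close>, the square of \<open>qtheta q (z / y 0)\<close> splits off from the
  determinant. The cofactor has degree two, and two further zeros force it to vanish.
\<close>

lemma bracket:
  assumes det: "\<And>i. i \<in> {1, 2} \<Longrightarrow>
      \<alpha> 1 * qbase (c 1) (y 0) (y i) * (\<beta> 2 * qbase (d 2) (y 0) (y i))
      = \<alpha> 2 * qbase (c 2) (y 0) (y i) * (\<beta> 1 * qbase (d 1) (y 0) (y i))"
    and z: "z \<noteq> 0"
  shows "\<alpha> 1 * qtheta q (z * y 0 / c 1) * (\<beta> 2 * qtheta q (z * y 0 / d 2))
      = \<alpha> 2 * qtheta q (z * y 0 / c 2) * (\<beta> 1 * qtheta q (z * y 0 / d 1))"
proof -
  define br where "br z =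
      (\<alpha> 1 * \<beta> 2) * (qtheta q (z * y 0 / c 1) * qtheta q (z * y 0 / d 2))
    + (- \<alpha> 2 * \<beta> 1) * (qtheta q (z * y 0 / c 2) * qtheta q (z * y 0 / d 1))" for z
  have y0: "y 0 \<noteq> 0" using y_nonzero by simp
  have *: "(\<lambda>z. qtheta q (z * y 0 / e)) \<in> qspace 1 (- (e / y 0))" if "e \<noteq> 0" for e
    using qtheta_in_qspace[of "e / y 0"] that y0 by simp
  have **: "(\<lambda>z. qtheta q (z * y 0 / e) * qtheta q (z * y 0 / e')) \<in> qspace 2 (e * e' / (y 0 * y 0))"
    if "e \<noteq> 0" "e' \<noteq> 0" for e e'
    using qspace_mult[OF *[OF that(1)] *[OF that(2)]] by (simp add: one_add_one)
  have "br \<in> qspace 2 (c 1 * d 2 / (y 0 * y 0))"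
    unfolding br_def [abs_def]
  proof (intro qspace_lincomb)
    show "(\<lambda>z. qtheta q (z * y 0 / c 2) * qtheta q (z * y 0 / d 1)) \<in> qspace 2 (c 1 * d 2 / (y 0 * y 0))"
      unfolding prod_cd by (intro ** c_nonzero d_nonzero)
  qed (intro ** c_nonzero d_nonzero)
  moreover have br_y: "br (y i) = 0" if i: "i \<in> {1, 2}" for i
  proof -
    have "qtheta q (y i / y 0) \<noteq> 0"
      using y_nonzero y_distinct i by (subst qtheta_divide_eq_0_iff) auto
    moreover have "qtheta q (y i / y 0) ^ 2 * br (y i) = 0"
      using det[OF i] by (simp add: br_def qbase_def algebra_simps power2_eq_square)
    ultimately show ?thesis by simp
  qed
  \<comment> \<open>The cofactor may not vanish at both \<open>y 1\<close> and \<open>y 2\<close>: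
    by the Fuchs relation the opposite congruence would say that \<open>y 3\<close> is congruent to
    \<open>y 0\<close>.\<close>
  moreover have "\<not> qequiv q (c 1 * d 2 / (y 0 * y 0)) (y 1 * y 2)"
  proof -
    have "c 1 * d 2 / (y 0 * y 0) / (y 1 * y 2) = y 3 / y 0"
      unfolding prod_y [symmetric] using y_nonzero[of 0] y_nonzero[of 1] y_nonzero[of 2] by simp
    from qequiv_cross[OF this] show ?thesis using y_distinct[of 3 0] by simp
  qed
  ultimately have "br z = 0"
    using qspace_2_eq_0[of br "c 1 * d 2 / (y 0 * y 0)" "y 1" "y 2" z] z y_nonzero c_nonzero d_nonzero
      y_distinct[of 2 1] by simp
  then show ?thesis by (simp add: br_def algebra_simps)
qed

lemma multiple_of_qbase:
  shows "h \<in> qspace 2 (c a) \<Longrightarrow> h (y 0) = 0 \<Longrightarrow> \<exists>\<beta>. \<forall>z. z \<noteq> 0 \<longrightarrow> h z = \<beta> * qbase (c a) (y 0) z"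
    and "h \<in> qspace 2 (d a) \<Longrightarrow> h (y 0) = 0 \<Longrightarrow> \<exists>\<beta>. \<forall>z. z \<noteq> 0 \<longrightarrow> h z = \<beta> * qbase (d a) (y 0) z"
  using qspace_2_multiple[of h "c a" "y 0" "y 1"] qspace_2_multiple[of h "d a" "y 0" "y 1"]
    y_nonzero[of 0] y_nonzero[of 1] c_nonzero[of a] d_nonzero[of a] y_distinct[of 1 0]
    c_generic[of 0 1 a] d_generic[of 0 1 a]
  by (metis one_less_numeral_iff semiring_norm(76) zero_less_numeral zero_neq_one)+

text \<open>Serves to show that \<open>M (x k)\<close> has rank 1 rather than 0. All four entries
  are multiples of functions \<open>qbase\<close>, and \<open>bracket\<close> applies to their
  cofactors.\<close>

lemma det_eq_0_of_common_zero:
  assumes F: "\<And>a. F a \<in> qspace 2 (c a)" "\<And>a. F a (y 0) = 0"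
    and G: "\<And>a. G a \<in> qspace 2 (d a)" "\<And>a. G a (y 0) = 0"
    and det: "\<And>i. i \<in> {1, 2} \<Longrightarrow> F 1 (y i) * G 2 (y i) = F 2 (y i) * G 1 (y i)"
    and z: "z \<noteq> 0"
  shows "F 1 z * G 2 z = F 2 z * G 1 z"
proof -
  obtain \<alpha> where \<alpha>: "\<And>a z. z \<noteq> 0 \<Longrightarrow> F a z = \<alpha> a * qbase (c a) (y 0) z"
    using multiple_of_qbase(1)[OF F] by metis
  obtain \<beta> where \<beta>: "\<And>a z. z \<noteq> 0 \<Longrightarrow> G a z = \<beta> a * qbase (d a) (y 0) z"
    using multiple_of_qbase(2)[OF G] by metis
  have nz: "y i \<noteq> 0" if "i \<in> {1, 2}" for i using that y_nonzero by auto
  have "\<alpha> 1 * qtheta q (z * y 0 / c 1) * (\<beta> 2 * qtheta q (z * y 0 / d 2))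
      = \<alpha> 2 * qtheta q (z * y 0 / c 2) * (\<beta> 1 * qtheta q (z * y 0 / d 1))"
    using det by (intro bracket z) (simp add: \<alpha>[OF nz] \<beta>[OF nz])
  then have "qtheta q (z / y 0) ^ 2 * (\<alpha> 1 * qtheta q (z * y 0 / c 1) * (\<beta> 2 * qtheta q (z * y 0 / d 2)))
      = qtheta q (z / y 0) ^ 2 * (\<alpha> 2 * qtheta q (z * y 0 / c 2) * (\<beta> 1 * qtheta q (z * y 0 / d 1)))"
    by simp
  then show ?thesis
    by (simp add: \<alpha>[OF z] \<beta>[OF z] qbase_def power2_eq_square mult_ac)
qed

text \<open>When a row is prescribed, \<open>(s, t)\<close> is visible only through the values of
  \<open>g\<close> at \<open>y 0\<close>, so these must determine it. If both vanish,
  \<open>bracket\<close> yields an identity between two products of theta functions without common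
  zeros.\<close>

lemma g_0_independent:
  assumes "\<And>a. g a s t (y 0) = 0"
  shows "s = 0" "t = 0"
proof -
  obtain \<beta> where \<beta>: "\<And>a z. z \<noteq> 0 \<Longrightarrow> g a s t z = \<beta> a * qbase (d a) (y 0) z"
    using multiple_of_qbase(2)[OF g_in_qspace assms] by metis
  have nz: "y i \<noteq> 0" if "i \<in> {1, 2}" for i using that y_nonzero by auto
  have eq: "1 * qtheta q (z * y 0 / c 1) * (\<beta> 2 * qtheta q (z * y 0 / d 2))
      = 1 * qtheta q (z * y 0 / c 2) * (\<beta> 1 * qtheta q (z * y 0 / d 1))" if "z \<noteq> 0" for z
  proof (intro bracket[where \<alpha> = "\<lambda>_. 1"] that)
    fix i :: nat assume i: "i \<in> {1, 2}"
    have "f 1 (y i) * g 2 s t (y i) = f 2 (y i) * g 1 s t (y i)"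
      using i by (auto simp: g_1 g_2)
    then show "1 * qbase (c 1) (y 0) (y i) * (\<beta> 2 * qbase (d 2) (y 0) (y i))
      = 1 * qbase (c 2) (y 0) (y i) * (\<beta> 1 * qbase (d 1) (y 0) (y i))"
      unfolding \<beta>[OF nz[OF i]] f_def by simp
  qed
  have y0: "y 0 \<noteq> 0" using y_nonzero by simp
  have c21: "\<not> qequiv q (c 2) (c 1)" using c12 qequiv_sym by blast
  \<comment> \<open>At \<open>c 1 / y 0\<close> the left side vanishes, while the theta values on
    the right, at \<open>c 1 / c 2\<close> and \<open>c 1 / d 1\<close>, do not. The point
    \<open>c 2 / y 0\<close> treats \<open>\<beta> 2\<close> in the same way.\<close>
  have "\<beta> 1 = 0"
    using eq[of "c 1 / y 0"] y0 c_nonzero d_nonzero c12 cd[of 1]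
    by (simp add: qtheta_divide_eq_0_iff)
  moreover have "\<beta> 2 = 0"
    using eq[of "c 2 / y 0"] y0 c_nonzero d_nonzero c21 cd[of 2]
    by (simp add: qtheta_divide_eq_0_iff)
  ultimately have "\<beta> a = 0" for a using exhaust_2[of a] by auto
  then have "g 1 s t (y 1) = 0" "g 1 s t (y 2) = 0" using \<beta> nz by auto
  then show "s = 0" "t = 0" using f_nonzero[of 1 1] f_nonzero[of 2 1] by (auto simp: g_1 g_2)
qed

text \<open>If \<delta> were 0, every \<open>g 1 s t\<close> would vanish at the second zero
  \<open>c 1 / y 0\<close> of \<open>f 1\<close>. These functions exhaust the space of multiplier
  \<open>d 1\<close>, which has no common zero.\<close>

lemma \<delta>_nonzero: "\<delta> 1 0 \<noteq> 0 \<or> \<delta> 0 1 \<noteq> 0"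
proof (rule ccontr)
  assume "\<not> ?thesis"
  then have \<delta>: "\<delta> s t = 0" for s t using \<delta>_linear[of s t] by simp
  have y0: "y 0 \<noteq> 0" using y_nonzero by simp
  define z1 where "z1 = c 1 / y 0"
  have z1: "z1 \<noteq> 0" using c_nonzero y0 by (simp add: z1_def)
  have g_z1: "g 1 s t z1 = 0" for s t
  proof -
    obtain w where w: "w \<noteq> 0" "qtheta q (w / y 0) \<noteq> 0"
      using ex_qtheta_nonzero[of "{y 0}"] y0 by auto
    have hol: "(\<lambda>z. qtheta q (z * y 0 / c a)) holomorphic_on - {0}" for a
      using qtheta_scaled_holomorphic[of "y 0 / c a"] y0 c_nonzero by simp
    have "qtheta q (z1 * y 0 / c 1) * g 2 s t z1 - qtheta q (z1 * y 0 / c 2) * g 1 s t z1 = 0"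
    proof (rule holomorphic_prod_eq_0[where F = "\<lambda>z. qtheta q (z / y 0)" and w = w, OF _ _ _ w(2,1) z1])
      show "(\<lambda>z. qtheta q (z / y 0)) holomorphic_on - {0}"
        using qspaceD(1)[OF qtheta_in_qspace[OF y0]] .
      show "(\<lambda>z. qtheta q (z * y 0 / c 1) * g 2 s t z - qtheta q (z * y 0 / c 2) * g 1 s t z)
          holomorphic_on - {0}"
        by (intro holomorphic_intros hol qspaceD(1)[OF g_in_qspace])
      show "qtheta q (z / y 0) *
          (qtheta q (z * y 0 / c 1) * g 2 s t z - qtheta q (z * y 0 / c 2) * g 1 s t z) = 0"
        if "z \<noteq> 0" for z
        using det_f_g[OF that, of s t] \<delta>[of s t] by (simp add: f_def qbase_def algebra_simps)
    qed
    moreover have "qtheta q (c 1 / c 2) \<noteq> 0" using c12 c_nonzero by (simp add: qtheta_divide_eq_0_iff)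
    ultimately show ?thesis using y0 c_nonzero by (simp add: z1_def)
  qed
  \<comment> \<open>A common zero would be a zero of each \<open>qbase (d 1) (y i)\<close>. Each
    alternative can hold for at most one \<open>i\<close>, which is contradictory already for three
    indices.\<close>
  have cases: "qequiv q z1 (y i) \<or> qequiv q (z1 * y i) (d 1)" if "i < 4" for i
  proof -
    have "qbase (d 1) (y i) z1 = 0"
      using g_unique[OF qbase_in_qspace z1, of "y i"] y_nonzero that d_nonzero g_z1 by simp
    then show ?thesis using z1 y_nonzero that d_nonzero by (simp add: qbase_eq_0_iff)
  qed
  have no1: False if "i < 4" "j < 4" "i \<noteq> j" "qequiv q z1 (y i)" "qequiv q z1 (y j)" for i j
    using qequiv_trans[OF qequiv_sym[OF that(4)] that(5) z1] y_distinct that by blast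
  have no2: False if "i < 4" "j < 4" "i \<noteq> j" "qequiv q (z1 * y i) (d 1)" "qequiv q (z1 * y j) (d 1)" for i j
    using qequiv_trans[OF that(4) qequiv_sym[OF that(5)] d_nonzero] y_distinct[of i j] that z1
      qequiv_cancel[of z1 "y i" "y j"] by (simp add: mult.commute)
  show False
    using cases[of 0] cases[of 1] cases[of 2] no1[of 0 1] no1[of 0 2] no1[of 1 2]
      no2[of 0 1] no2[of 0 2] no2[of 1 2]
    by auto
qed

text \<open>At \<open>y 1\<close>, \<open>y 2\<close> and \<open>y 3\<close> the index 2 gives the
  same ratio, by \<open>g_W\<close>. For a prescribed column these are the ratios
  \<open>\<rho>\<close> or their inverses.\<close>

definition W :: "complex \<Rightarrow> complex \<Rightarrow> complex \<Rightarrow> complex" where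
  "W z s t = g 1 s t z / f 1 z"

lemma W_linear: "W z s t = s * W z 1 0 + t * W z 0 1"
  unfolding W_def by (subst g_linear) (simp add: add_divide_distrib)

lemma W_1: "W (y 1) s t = s" and W_2: "W (y 2) s t = t"
  using f_nonzero[of 1 1] f_nonzero[of 2 1] by (simp_all add: W_def g_1 g_2)

lemma g_W:
  assumes "0 < i" "i < 4"
  shows "g a s t (y i) = W (y i) s t * f a (y i)"
proof -
  have "i = 1 \<or> i = 2 \<or> i = 3" using assms by auto
  then show ?thesis using g_3[of a s t] by (auto simp: W_1 W_2 g_1 g_2) (simp add: W_def)
qed

text \<open>The factors \<alpha> form a torus element: they scale rows when a column is prescribed,
  and columns when a row is. The same \<alpha> therefore multiplies \<open>f\<close> and
  \<open>g\<close>.\<close>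

lemma representation:
  assumes F: "\<And>a. F a \<in> qspace 2 (c a)" "\<And>a. F a (y 0) = 0" "\<And>a. \<exists>z. z \<noteq> 0 \<and> F a z \<noteq> 0"
    and G: "\<And>a. G a \<in> qspace 2 (d a)"
    and det: "\<And>i. i \<in> {1, 2} \<Longrightarrow> F 1 (y i) * G 2 (y i) = F 2 (y i) * G 1 (y i)"
  obtains \<alpha> s t where "\<And>a. \<alpha> a \<noteq> 0" "\<And>a z. z \<noteq> 0 \<Longrightarrow> F a z = \<alpha> a * f a z"
    "\<And>a z. z \<noteq> 0 \<Longrightarrow> G a z = \<alpha> a * g a s t z"
proof -
  obtain \<alpha> where \<alpha>: "\<And>a z. z \<noteq> 0 \<Longrightarrow> F a z = \<alpha> a * f a z"
    unfolding f_def using multiple_of_qbase(1)[OF F(1,2)] by metis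
  have \<alpha>0: "\<alpha> a \<noteq> 0" for a using F(3)[of a] \<alpha> by auto
  define H where "H a z = G a z / \<alpha> a" for a z
  have "(\<lambda>z. (1 / \<alpha> a) * G a z + 0 * G a z) \<in> qspace 2 (d a)" for a
    by (intro qspace_lincomb G)
  then have H: "H a \<in> qspace 2 (d a)" for a by (simp add: H_def [abs_def])
  \<comment> \<open>After division by \<alpha>, the vanishing determinant says that both entries
    have the same ratio to \<open>f\<close>, so one pair \<open>(s, t)\<close> serves both
    indices.\<close>
  have quot: "H a (y i) / f a (y i) = H 1 (y i) / f 1 (y i)" if "i \<in> {1, 2}" for a i
  proof -
    have i: "0 < i" "i < 4" using that by auto
    have "\<alpha> 1 * f 1 (y i) * G 2 (y i) = \<alpha> 2 * f 2 (y i) * G 1 (y i)"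
      using det[OF that] \<alpha> y_nonzero[OF i(2)] by simp
    then have "H 2 (y i) / f 2 (y i) = H 1 (y i) / f 1 (y i)"
      using \<alpha>0[of 1] \<alpha>0[of 2] f_nonzero[OF i, of 1] f_nonzero[OF i, of 2] by (simp add: H_def field_simps)
    then show ?thesis using exhaust_2[of a] by auto
  qed
  let ?s = "H 1 (y 1) / f 1 (y 1)" and ?t = "H 1 (y 2) / f 1 (y 2)"
  have "G a z = \<alpha> a * g a ?s ?t z" if z: "z \<noteq> 0" for a z
  proof -
    have "H a z = g a ?s ?t z"
      using g_unique[OF H z, of a] quot[of 1 a] quot[of 2 a] by simp
    then show ?thesis using \<alpha>0[of a] by (simp add: H_def field_simps)
  qed
  with \<alpha>0 \<alpha> show ?thesis by (rule that)
qed

lemma \<Theta>_y: "i < 4 \<Longrightarrow> \<Theta> (y i) = 0"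
proof -
  assume "i < 4"
  then have "i = 0 \<or> i = 1 \<or> i = 2 \<or> i = 3" by auto
  then show ?thesis using y_nonzero[of 0] y_nonzero[of 1] y_nonzero[of 2] y_nonzero[of 3]
    by (auto simp: \<Theta>_def)
qed

end

section \<open>Multihomogeneous coordinates\<close>

definition scale6 :: "complex \<Rightarrow> C6 \<Rightarrow> C6" where
  "scale6 \<kappa> = (\<lambda>(a, b, c, d, e, f). (\<kappa> * a, \<kappa> * b, \<kappa> * c, \<kappa> * d, \<kappa> * e, \<kappa> * f))"

text \<open>
  \<open>hmons\<close> for arbitrary homogeneous coordinates \<open>(p m : r m)\<close> of the four points, in place of the
  normalized \<open>(hx, hy)\<close>.
\<close>

definition homs :: "(nat \<Rightarrow> complex) \<Rightarrow> (nat \<Rightarrow> complex) \<Rightarrow> C6" where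
  "homs p r = (p 1 * p 2 * r 3 * r 4, p 1 * p 3 * r 2 * r 4, p 1 * p 4 * r 2 * r 3,
     p 2 * p 3 * r 1 * r 4, p 2 * p 4 * r 1 * r 3, p 3 * p 4 * r 1 * r 2)"

lemma atLeastAtMost_1_4: "{1..4 :: nat} = {1, 2, 3, 4}"
  by auto

lemma hmons_eq_homs: "hmons \<rho> = homs (hx \<circ> \<rho>) (hy \<circ> \<rho>)"
  by (simp add: hmons_def hmon_def homs_def atLeastAtMost_1_4 mult_ac del: One_nat_def)

lemma scale6_scale6 [simp]: "scale6 a (scale6 b e) = scale6 (a * b) e"
  by (auto simp: scale6_def split: prod.split)

lemma scale6_1 [simp]: "scale6 1 e = e"
  by (auto simp: scale6_def split: prod.split)

lemma lin_form_scale6: "lin_form q c1 c2 x (scale6 \<kappa> e) = \<kappa> * lin_form q c1 c2 x e"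
  by (auto simp: scale6_def lin_form_def algebra_simps split: prod.split)

lemma lin_form_add: "lin_form q c1 c2 x (e + e') = lin_form q c1 c2 x e + lin_form q c1 c2 x e'"
  by (auto simp: lin_form_def algebra_simps split: prod.split)

lemma pr4_scale6: "pr4 (scale6 \<kappa> e) = \<kappa> *s pr4 e"
  by (auto simp: scale6_def pr4_def vec_eq_iff forall_4 split: prod.split)

lemma pr4_add: "pr4 (e + e') = pr4 e + pr4 e'"
  by (auto simp: pr4_def vec_eq_iff forall_4 split: prod.split)

text \<open>Each monomial uses every point once, hence the product of all \<open>\<tau> m\<close>,
  and has degree two in \<open>p\<close> and in \<open>r\<close>, hence the square of
  \<open>a * b\<close>. So neither the choice of coordinates nor the torus changes the class of
  \<open>homs\<close>.\<close>

lemma homs_scale: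
  assumes "\<And>m. m \<in> {1..4} \<Longrightarrow> p' m = \<tau> m * b * p m" "\<And>m. m \<in> {1..4} \<Longrightarrow> r' m = \<tau> m * a * r m"
  shows "homs p' r' = scale6 ((\<Prod>m\<in>{1..4}. \<tau> m) * (a * b)\<^sup>2) (homs p r)"
proof -
  have "p' 1 = \<tau> 1 * b * p 1" "p' 2 = \<tau> 2 * b * p 2" "p' 3 = \<tau> 3 * b * p 3" "p' 4 = \<tau> 4 * b * p 4"
    "r' 1 = \<tau> 1 * a * r 1" "r' 2 = \<tau> 2 * a * r 2" "r' 3 = \<tau> 3 * a * r 3" "r' 4 = \<tau> 4 * a * r 4"
    using assms by auto
  then show ?thesis
    by (simp add: homs_def scale6_def atLeastAtMost_1_4 power2_eq_square mult_ac del: One_nat_def)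
qed

lemma eta_eq: "eta q R \<sigma> x \<rho> = scale6 (1 / Phi' q R \<sigma> x \<rho>) (hmons \<rho>)"
  by (auto simp: eta_def scale6_def split: prod.split)

text \<open>The quotients are homogeneous of degree 0, so \<eta> can be computed from any convenient
  coordinates in place of \<open>hx\<close>, \<open>hy\<close>.\<close>

lemma eta_of_scaled:
  assumes "hmons \<rho> = scale6 \<kappa> e" "\<kappa> \<noteq> 0"
  shows "eta q R \<sigma> x \<rho> = scale6 (1 / lin_form q (R $ 1 / \<sigma> $ 2) (R $ 1 / \<sigma> $ 2) x e) e"
  using assms by (simp add: eta_eq Phi'_def lin_form_scale6)

section \<open>Matrices of rank one and their ratios\<close>

lemma det2: "det (A :: complex ^ 2 ^ 2) = A $ 1 $ 1 * A $ 2 $ 2 - A $ 1 $ 2 * A $ 2 $ 1"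
  by (rule det_2)

lemma det2': "i \<noteq> i' \<Longrightarrow> j \<noteq> j' \<Longrightarrow>
  det (A :: complex ^ 2 ^ 2) = 0 \<longleftrightarrow> A $ i $ j * A $ i' $ j' = A $ i $ j' * A $ i' $ j"
  using exhaust_2[of i] exhaust_2[of i'] exhaust_2[of j] exhaust_2[of j']
  by (auto simp: det2 mult_ac)

lemma P1_ratio_coords:
  assumes "a * b0 = a0 * b" "a \<noteq> 0 \<or> b \<noteq> 0" "a0 \<noteq> 0 \<or> b0 \<noteq> 0"
  shows "\<exists>\<tau>. \<tau> \<noteq> 0 \<and> a0 = \<tau> * hx (P1_ratio a b) \<and> b0 = \<tau> * hy (P1_ratio a b)"
proof (cases "b = 0")
  case True
  then show ?thesis using assms by (intro exI[of _ a0]) (auto simp: P1_ratio_def)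
next
  case False
  then have "b0 \<noteq> 0" using assms by auto
  then show ?thesis using assms False by (intro exI[of _ b0]) (auto simp: P1_ratio_def field_simps)
qed

lemma rank1_entries:
  assumes "det (A :: complex ^ 2 ^ 2) = 0"
  shows "A $ i $ 2 * A $ i' $ 1 = A $ i' $ 2 * A $ i $ 1" "A $ 1 $ j * A $ 2 $ j' = A $ 1 $ j' * A $ 2 $ j"
  using assms exhaust_2[of i] exhaust_2[of i'] exhaust_2[of j] exhaust_2[of j']
  by (auto simp: det2 mult_ac)

lemma row_nonzero_iff: "row i (A :: complex ^ 2 ^ 2) \<noteq> 0 \<longleftrightarrow> A $ i $ 2 \<noteq> 0 \<or> A $ i $ 1 \<noteq> 0"
  by (auto simp: row_def vec_eq_iff forall_2)

lemma column_nonzero_iff: "column j (A :: complex ^ 2 ^ 2) \<noteq> 0 \<longleftrightarrow> A $ 1 $ j \<noteq> 0 \<or> A $ 2 $ j \<noteq> 0"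
  by (auto simp: column_def vec_eq_iff forall_2)

text \<open>Rows of a singular matrix are proportional, so the row chosen by \<open>SOME\<close> in
  \<open>rho\<close> may be replaced by any nonzero row.\<close>

lemma rho_coords:
  assumes det: "det (M (x k)) = 0" and i: "M (x k) $ i $ 2 \<noteq> 0 \<or> M (x k) $ i $ 1 \<noteq> 0"
  shows "\<exists>\<tau>. \<tau> \<noteq> 0 \<and> M (x k) $ i $ 2 = \<tau> * hx (rho x M k) \<and> M (x k) $ i $ 1 = \<tau> * hy (rho x M k)"
proof -
  define i' where "i' = (SOME i. row i (M (x k)) \<noteq> 0)"
  have "row i' (M (x k)) \<noteq> 0"
    unfolding i'_def by (rule someI[of _ i]) (use i in \<open>simp add: row_nonzero_iff\<close>)
  then have "M (x k) $ i' $ 2 \<noteq> 0 \<or> M (x k) $ i' $ 1 \<noteq> 0"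
    by (simp add: row_nonzero_iff)
  from P1_ratio_coords[OF rank1_entries(1)[OF det] this i]
  show ?thesis by (simp add: rho_def i'_def Let_def)
qed

lemma rho'_coords:
  assumes det: "det (M (x k)) = 0" and j: "M (x k) $ 1 $ j \<noteq> 0 \<or> M (x k) $ 2 $ j \<noteq> 0"
  shows "\<exists>\<tau>. \<tau> \<noteq> 0 \<and> M (x k) $ 1 $ j = \<tau> * hx (rho' x M k) \<and> M (x k) $ 2 $ j = \<tau> * hy (rho' x M k)"
proof -
  define j' where "j' = (SOME j. column j (M (x k)) \<noteq> 0)"
  have "column j' (M (x k)) \<noteq> 0"
    unfolding j'_def by (rule someI[of _ j]) (use j in \<open>simp add: column_nonzero_iff\<close>)
  then have "M (x k) $ 1 $ j' \<noteq> 0 \<or> M (x k) $ 2 $ j' \<noteq> 0"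
    by (simp add: column_nonzero_iff)
  from P1_ratio_coords[OF rank1_entries(2)[OF det] this j]
  show ?thesis by (simp add: rho'_def j'_def Let_def)
qed

lemma hx_eq_0_iff: "hx p = 0 \<longleftrightarrow> p = Fin 0" and hy_eq_0_iff: "hy p = 0 \<longleftrightarrow> p = Infty"
  by (cases p; simp)+

lemma rho_eq_iff:
  assumes det: "det (M (x k)) = 0" and nz: "M (x k) \<noteq> 0"
  shows "rho x M k = Fin 0 \<longleftrightarrow> (\<forall>i. M (x k) $ i $ 2 = 0)"
    and "rho x M k = Infty \<longleftrightarrow> (\<forall>i. M (x k) $ i $ 1 = 0)"
proof -
  obtain i0 where i0: "M (x k) $ i0 $ 2 \<noteq> 0 \<or> M (x k) $ i0 $ 1 \<noteq> 0"
    using nz by (auto simp: vec_eq_iff forall_2)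
  have "M (x k) $ i $ 2 = 0" if "hx (rho x M k) = 0" for i
    using rho_coords[of M x k i, OF det] that by auto
  moreover have "M (x k) $ i $ 1 = 0" if "hy (rho x M k) = 0" for i
    using rho_coords[of M x k i, OF det] that by auto
  ultimately show "rho x M k = Fin 0 \<longleftrightarrow> (\<forall>i. M (x k) $ i $ 2 = 0)"
    "rho x M k = Infty \<longleftrightarrow> (\<forall>i. M (x k) $ i $ 1 = 0)"
    using rho_coords[of M x k i0, OF det i0] by (auto simp: hx_eq_0_iff hy_eq_0_iff)
qed

lemma rho'_eq_iff:
  assumes det: "det (M (x k)) = 0" and nz: "M (x k) \<noteq> 0"
  shows "rho' x M k = Fin 0 \<longleftrightarrow> (\<forall>j. M (x k) $ 1 $ j = 0)"
    and "rho' x M k = Infty \<longleftrightarrow> (\<forall>j. M (x k) $ 2 $ j = 0)"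
proof -
  obtain j0 where j0: "M (x k) $ 1 $ j0 \<noteq> 0 \<or> M (x k) $ 2 $ j0 \<noteq> 0"
    using nz by (auto simp: vec_eq_iff forall_2)
  have "M (x k) $ 1 $ j = 0" if "hx (rho' x M k) = 0" for j
    using rho'_coords[of M x k j, OF det] that by auto
  moreover have "M (x k) $ 2 $ j = 0" if "hy (rho' x M k) = 0" for j
    using rho'_coords[of M x k j, OF det] that by auto
  ultimately show "rho' x M k = Fin 0 \<longleftrightarrow> (\<forall>j. M (x k) $ 1 $ j = 0)"
    "rho' x M k = Infty \<longleftrightarrow> (\<forall>j. M (x k) $ 2 $ j = 0)"
    using rho'_coords[of M x k j0, OF det j0] by (auto simp: hx_eq_0_iff hy_eq_0_iff)
qed

text \<open>At each point the coordinates may be read from a different row, with its own factor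
  \<tau>; \<open>a\<close> and \<open>b\<close> are column factors common to all four
  points.\<close>

lemma hmons_rho:
  assumes det: "\<And>m. m \<in> {1..4} \<Longrightarrow> det (M (x m)) = 0" and ab: "a \<noteq> 0" "b \<noteq> 0"
    and rows: "\<And>m. m \<in> {1..4} \<Longrightarrow> \<exists>i \<tau>. \<tau> \<noteq> 0 \<and> M (x m) $ i $ 1 = \<tau> * a * r m \<and> M (x m) $ i $ 2 = \<tau> * b * p m"
    and nz: "\<And>m. m \<in> {1..4} \<Longrightarrow> r m \<noteq> 0 \<or> p m \<noteq> 0"
  shows "\<exists>\<kappa>. \<kappa> \<noteq> 0 \<and> hmons (rho x M) = scale6 \<kappa> (homs p r)"
proof -
  have "\<exists>\<tau>. \<tau> \<noteq> 0 \<and> hx (rho x M m) = \<tau> * b * p m \<and> hy (rho x M m) = \<tau> * a * r m" if m: "m \<in> {1..4}" for m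
  proof -
    obtain i \<tau> where \<tau>: "\<tau> \<noteq> 0" "M (x m) $ i $ 1 = \<tau> * a * r m" "M (x m) $ i $ 2 = \<tau> * b * p m"
      using rows[OF m] by blast
    have "M (x m) $ i $ 2 \<noteq> 0 \<or> M (x m) $ i $ 1 \<noteq> 0"
      using nz[OF m] ab \<tau> by auto
    from rho_coords[of M x m, OF det[OF m] this] obtain \<tau>' where
      \<tau>': "\<tau>' \<noteq> 0" "\<tau> * b * p m = \<tau>' * hx (rho x M m)" "\<tau> * a * r m = \<tau>' * hy (rho x M m)"
      using \<tau> by metis
    show ?thesis
      using \<tau> \<tau>'(1) \<tau>'(2,3)[symmetric] by (intro exI[of _ "\<tau> / \<tau>'"]) (auto simp: field_simps)
  qed
  then obtain \<tau> where \<tau>: "\<And>m. m \<in> {1..4} \<Longrightarrow> \<tau> m \<noteq> 0"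
    "\<And>m. m \<in> {1..4} \<Longrightarrow> (hx \<circ> rho x M) m = \<tau> m * b * p m"
    "\<And>m. m \<in> {1..4} \<Longrightarrow> (hy \<circ> rho x M) m = \<tau> m * a * r m"
    unfolding o_def by metis
  have "hmons (rho x M) = scale6 ((\<Prod>m\<in>{1..4}. \<tau> m) * (a * b)\<^sup>2) (homs p r)"
    unfolding hmons_eq_homs by (rule homs_scale) (fact \<tau>(2) \<tau>(3))+
  moreover have "(\<Prod>m\<in>{1..4}. \<tau> m) * (a * b)\<^sup>2 \<noteq> 0"
    using \<tau>(1) ab by simp
  ultimately show ?thesis by blast
qed

section \<open>Orbits of the torus\<close>

lemma invertible_matrix_inv_right:
  fixes A :: "'a :: semiring_1 ^ 'n ^ 'n"
  shows "invertible A \<Longrightarrow> A ** matrix_inv A = mat 1"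
  unfolding invertible_def matrix_inv_def by (rule someI2_ex) auto

lemma D2_entries:
  assumes "\<Gamma> \<in> D2"
  obtains \<gamma> where "\<And>i. \<gamma> i \<noteq> 0" "\<And>A i j. (\<Gamma> ** A) $ i $ j = \<gamma> i * (A :: complex ^ 2 ^ 2) $ i $ j"
proof -
  have inv: "\<Gamma> ** matrix_inv \<Gamma> = mat 1" and off: "\<And>i j. i \<noteq> j \<Longrightarrow> \<Gamma> $ i $ j = 0"
    using assms by (auto simp: D2_def invertible_matrix_inv_right)
  have eq: "(\<Gamma> ** A) $ i $ j = \<Gamma> $ i $ i * (A :: complex ^ 2 ^ 2) $ i $ j" for A i j
    using exhaust_2[of i] off[of 1 2] off[of 2 1]
    by (auto simp: matrix_matrix_mult_def sum_2)
  have "\<Gamma> $ i $ i \<noteq> 0" for i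
    using eq[of "matrix_inv \<Gamma>" i i] by (auto simp: inv mat_def)
  then show ?thesis using that[of "\<lambda>i. \<Gamma> $ i $ i"] eq by blast
qed

lemma D2_inv_entries:
  assumes "\<Delta> \<in> D2"
  obtains \<epsilon> where "\<And>i. \<epsilon> i \<noteq> 0" "\<And>A i j. (A ** matrix_inv \<Delta>) $ i $ j = (A :: complex ^ 2 ^ 2) $ i $ j * \<epsilon> j"
proof -
  obtain \<gamma> where \<gamma>: "\<And>i. \<gamma> i \<noteq> 0" "\<And>A i j. (\<Delta> ** A) $ i $ j = \<gamma> i * (A :: complex ^ 2 ^ 2) $ i $ j"
    using D2_entries[OF assms] by metis
  have "\<Delta> ** matrix_inv \<Delta> = mat 1"
    using assms by (auto simp: D2_def invertible_matrix_inv_right)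
  then have "\<gamma> i * matrix_inv \<Delta> $ i $ j = (if i = j then 1 else 0)" for i j
    using \<gamma>(2)[of "matrix_inv \<Delta>" i j] by (simp add: mat_def)
  from this[symmetric] have B: "matrix_inv \<Delta> $ i $ j = (if i = j then 1 / \<gamma> i else 0)" for i j
    using \<gamma>(1)[of i]
    by (metis mult_cancel_left mult_zero_right nonzero_mult_div_cancel_left times_divide_eq_right)
  have "(A ** matrix_inv \<Delta>) $ i $ j = A $ i $ j * (1 / \<gamma> j)" for A :: "complex ^ 2 ^ 2" and i j
    using exhaust_2[of j] by (auto simp: matrix_matrix_mult_def sum_2 B)
  then show ?thesis using that[of "\<lambda>j. 1 / \<gamma> j"] \<gamma>(1) by simp
qed

lemma H_orbit_self: "M \<in> V_star q R \<sigma> \<Longrightarrow> M \<in> H_orbit q R \<sigma> M"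
proof -
  assume M: "M \<in> V_star q R \<sigma>"
  have "invertible (mat 1 :: complex ^ 2 ^ 2)" by (auto simp: invertible_def intro!: exI[of _ "mat 1"])
  then have I: "mat 1 \<in> D2" by (auto simp: D2_def mat_def)
  have "matrix_inv (mat 1 :: complex ^ 2 ^ 2) = mat 1"
    using invertible_matrix_inv_right[OF \<open>invertible (mat 1 :: complex ^ 2 ^ 2)\<close>] by simp
  then show ?thesis
    using M I unfolding H_orbit_def H_rel_def by (auto intro!: bexI[of _ "mat 1"])
qed

lemma H_orbit_entries:
  assumes "N \<in> H_orbit q R \<sigma> M"
  obtains \<gamma> \<epsilon> where "\<And>i. \<gamma> i \<noteq> 0" "\<And>i. \<epsilon> i \<noteq> 0" "\<And>z i j. N z $ i $ j = \<gamma> i * M z $ i $ j * \<epsilon> j"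
proof -
  obtain \<Gamma> \<Delta> where N: "\<Gamma> \<in> D2" "\<Delta> \<in> D2" "N = (\<lambda>z. \<Gamma> ** M z ** matrix_inv \<Delta>)"
    using assms by (auto simp: H_orbit_def H_rel_def)
  obtain \<gamma> where \<gamma>: "\<And>i. \<gamma> i \<noteq> 0" "\<And>A i j. (\<Gamma> ** A) $ i $ j = \<gamma> i * (A :: complex ^ 2 ^ 2) $ i $ j"
    using D2_entries[OF N(1)] by metis
  obtain \<epsilon> where \<epsilon>: "\<And>i. \<epsilon> i \<noteq> 0" "\<And>A i j. (A ** matrix_inv \<Delta>) $ i $ j = (A :: complex ^ 2 ^ 2) $ i $ j * \<epsilon> j"
    using D2_inv_entries[OF N(2)] by metis
  show ?thesis using that[of \<gamma> \<epsilon>] \<gamma> \<epsilon> N(3) by simp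
qed

section \<open>Linearity of the six monomials in the parameters of a locus\<close>

lemma homs_linear_at:
  assumes "k \<in> {1..4}"
  shows "homs (p(k := s * p1 + t * p2)) (r(k := s * r1 + t * r2)) =
    scale6 s (homs (p(k := p1)) (r(k := r1))) + scale6 t (homs (p(k := p2)) (r(k := r2)))"
proof -
  have "k = 1 \<or> k = 2 \<or> k = 3 \<or> k = 4" using assms by auto
  then show ?thesis by (auto simp: homs_def scale6_def algebra_simps)
qed

text \<open>With the point \<open>k\<close> at 0 or infinity three of the six monomials vanish, and
  the other three are exactly the numbers \<open>w m\<close> with
  \<open>m \<noteq> k\<close>.\<close>

lemma homs_linear_off:
  assumes "k \<in> {1..4}" and w: "\<And>m. w m = s * w1 m + t * w2 m"
  shows "homs ((\<lambda>_. 1)(k := 0)) (w(k := 1)) =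
      scale6 s (homs ((\<lambda>_. 1)(k := 0)) (w1(k := 1))) + scale6 t (homs ((\<lambda>_. 1)(k := 0)) (w2(k := 1)))"
    and "homs (w(k := 1)) ((\<lambda>_. 1)(k := 0)) =
      scale6 s (homs (w1(k := 1)) ((\<lambda>_. 1)(k := 0))) + scale6 t (homs (w2(k := 1)) ((\<lambda>_. 1)(k := 0)))"
proof -
  have "k = 1 \<or> k = 2 \<or> k = 3 \<or> k = 4" using assms by auto
  then show "homs ((\<lambda>_. 1)(k := 0)) (w(k := 1)) =
      scale6 s (homs ((\<lambda>_. 1)(k := 0)) (w1(k := 1))) + scale6 t (homs ((\<lambda>_. 1)(k := 0)) (w2(k := 1)))"
    "homs (w(k := 1)) ((\<lambda>_. 1)(k := 0)) =
      scale6 s (homs (w1(k := 1)) ((\<lambda>_. 1)(k := 0))) + scale6 t (homs (w2(k := 1)) ((\<lambda>_. 1)(k := 0)))"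
    by (elim disjE; simp add: homs_def scale6_def w del: One_nat_def)+
qed

lemma homs_eq_0_iff:
  "homs p r = 0 \<longleftrightarrow> p 1 * p 2 * r 3 * r 4 = 0 \<and> p 1 * p 3 * r 2 * r 4 = 0 \<and> p 1 * p 4 * r 2 * r 3 = 0 \<and>
     p 2 * p 3 * r 1 * r 4 = 0 \<and> p 2 * p 4 * r 1 * r 3 = 0 \<and> p 3 * p 4 * r 1 * r 2 = 0"
  by (simp only: homs_def zero_prod_def prod.inject)

lemma homs_off_eq_0:
  assumes k: "k \<in> {1..4}" and m: "m \<in> {1..4}" "m \<noteq> k"
  shows "homs ((\<lambda>_. 1)(k := 0)) (w(k := 1)) = 0 \<Longrightarrow> w m = 0"
    and "homs (w(k := 1)) ((\<lambda>_. 1)(k := 0)) = 0 \<Longrightarrow> w m = 0"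
proof -
  have km: "k = 1 \<or> k = 2 \<or> k = 3 \<or> k = 4" "m = 1 \<or> m = 2 \<or> m = 3 \<or> m = 4" using k m by auto
  show "homs ((\<lambda>_. 1)(k := 0)) (w(k := 1)) = 0 \<Longrightarrow> w m = 0"
    using km m(2) unfolding homs_eq_0_iff by (elim disjE; simp)
  show "homs (w(k := 1)) ((\<lambda>_. 1)(k := 0)) = 0 \<Longrightarrow> w m = 0"
    using km m(2) unfolding homs_eq_0_iff by (elim disjE; simp)
qed

lemma homs_at_eq_0:
  assumes k: "k \<in> {1..4}" and nz: "\<And>m. m \<in> {1..4} \<Longrightarrow> m \<noteq> k \<Longrightarrow> p m \<noteq> 0 \<and> r m \<noteq> 0"
    and 0: "homs (p(k := p0)) (r(k := r0)) = 0"
  shows "p0 = 0 \<and> r0 = 0"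
proof -
  have "k = 1 \<or> k = 2 \<or> k = 3 \<or> k = 4" using k by auto
  then show ?thesis using 0 nz[of 1] nz[of 2] nz[of 3] nz[of 4] unfolding homs_eq_0_iff
    by (elim disjE; simp)
qed

section \<open>The lines on the Segre surface\<close>

text \<open>Tested at its zero \<open>(v, - u)\<close>, the second form shows that the first
  vanishes there too, so both have the same zero line. It is applied to \<delta> and the restriction
  of \<open>Phi'\<close>.\<close>

lemma linear_forms_proportional:
  fixes a b u v s t :: complex
  assumes nz: "a \<noteq> 0 \<or> b \<noteq> 0" and impl: "\<And>s t. s * a + t * b \<noteq> 0 \<Longrightarrow> s * u + t * v \<noteq> 0"
    and st: "s * u + t * v \<noteq> 0"
  shows "s * a + t * b \<noteq> 0"
proof
  assume 0: "s * a + t * b = 0"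
  have "v * a + (- u) * b = 0" using impl[of v "- u"] by auto
  then have "a * (s * u + t * v) = 0" "b * (s * u + t * v) = 0" using 0 by algebra+
  with st nz show False by simp
qed

locale segre = nome +
  fixes R \<sigma> :: "complex ^ 2" and x :: "nat \<Rightarrow> complex"
  assumes R_nonzero: "R $ i \<noteq> 0" and \<sigma>_nonzero: "\<sigma> $ j \<noteq> 0"
    and x_nonzero: "k \<in> {1..4} \<Longrightarrow> x k \<noteq> 0"
    and R12: "\<not> qequiv q (R $ 1) (R $ 2)" and \<sigma>12: "\<not> qequiv q (\<sigma> $ 1) (\<sigma> $ 2)"
    and x_distinct: "k \<in> {1..4} \<Longrightarrow> l \<in> {1..4} \<Longrightarrow> k \<noteq> l \<Longrightarrow> \<not> qequiv q (x k) (x l)"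
    and fuchs: "x 1 * x 2 * x 3 * x 4 = R $ 1 * R $ 2 / (\<sigma> $ 1 * \<sigma> $ 2)"
    and nonsplit: "k \<in> {1..4} \<Longrightarrow> l \<in> {1..4} \<Longrightarrow> k \<noteq> l \<Longrightarrow> \<not> qequiv q (R $ i / \<sigma> $ j) (x k * x l)"
    and elim_nonzero: "elim_det q R \<sigma> x \<noteq> 0"
    and Phi'_nonzero: "M \<in> F_set q R \<sigma> x \<Longrightarrow> Phi' q R \<sigma> x (rho x M) \<noteq> 0"
begin

declare One_nat_def [simp del]

abbreviation F where "F \<equiv> F_set q R \<sigma> x"

abbreviation \<eta> where "\<eta> M \<equiv> eta q R \<sigma> x (rho x M)"

text \<open>\<open>perm k\<close> enumerates \<open>{1..4}\<close> over \<open>{0..<4}\<close>, starting with \<open>k\<close>.\<close>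

definition perm :: "nat \<Rightarrow> nat \<Rightarrow> nat" where
  "perm k i = (if i = 0 then k else if i + 1 = k then 1 else i + 1)"

lemma perm_mem: "k \<in> {1..4} \<Longrightarrow> i < 4 \<Longrightarrow> perm k i \<in> {1..4}"
  by (auto simp: perm_def)

lemma perm_eq_iff: "k \<in> {1..4} \<Longrightarrow> perm k i = perm k j \<longleftrightarrow> i = j"
  by (auto simp: perm_def split: if_splits)

lemma perm_0: "perm k 0 = k"
  by (simp add: perm_def)

lemma perm_cover:
  assumes "k \<in> {1..4}" "m \<in> {1..4}" "m \<noteq> k"
  obtains i where "0 < i" "i < 4" "perm k i = m"
proof
  define i where "i = (if m = 1 then k - 1 else m - 1)"
  show "0 < i" "i < 4" "perm k i = m"
    using assms by (auto simp: i_def perm_def)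
qed

lemma perm_prod:
  assumes "k \<in> {1..4}"
  shows "x (perm k 0) * x (perm k 1) * x (perm k 2) * x (perm k 3) = x 1 * x 2 * x 3 * x 4"
proof -
  have "k = 1 \<or> k = 2 \<or> k = 3 \<or> k = 4" using assms by auto
  then show ?thesis by (auto simp: perm_def mult_ac)
qed

lemma perm_generic:
  assumes k: "k \<in> {1..4}"
  shows "i < 4 \<Longrightarrow> x (perm k i) \<noteq> 0"
    and "i < 4 \<Longrightarrow> j < 4 \<Longrightarrow> i \<noteq> j \<Longrightarrow> \<not> qequiv q (x (perm k i)) (x (perm k j))"
    and "i < 4 \<Longrightarrow> j < 4 \<Longrightarrow> i \<noteq> j \<Longrightarrow> \<not> qequiv q (R $ a / \<sigma> $ b) (x (perm k i) * x (perm k j))"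
  by (simp_all only: x_nonzero x_distinct nonsplit perm_mem k perm_eq_iff[OF k] not_False_eq_True)

lemma R_distinct: "i \<noteq> i' \<Longrightarrow> \<not> qequiv q (R $ i) (R $ i')"
  using exhaust_2[of i] exhaust_2[of i'] R12 qequiv_sym by auto

lemma \<sigma>_distinct: "j \<noteq> j' \<Longrightarrow> \<not> qequiv q (\<sigma> $ j) (\<sigma> $ j')"
  using exhaust_2[of j] exhaust_2[of j'] \<sigma>12 qequiv_sym by auto

lemma qequiv_same_\<sigma>: "qequiv q (R $ i / \<sigma> $ j) (R $ i' / \<sigma> $ j) \<longleftrightarrow> qequiv q (R $ i) (R $ i')"
  using \<sigma>_nonzero[of j] by (intro qequiv_cross) simp

lemma qequiv_same_R: "qequiv q (R $ i / \<sigma> $ j) (R $ i / \<sigma> $ j') \<longleftrightarrow> qequiv q (\<sigma> $ j') (\<sigma> $ j)"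
  using R_nonzero[of i] by (intro qequiv_cross) simp

lemma prod_two:
  assumes "i \<noteq> i'" "j \<noteq> j'"
  shows "x 1 * x 2 * x 3 * x 4 = R $ i / \<sigma> $ j * (R $ i' / \<sigma> $ j')"
  using assms exhaust_2[of i] exhaust_2[of i'] exhaust_2[of j] exhaust_2[of j'] fuchs
  by (auto simp: mult.commute)

text \<open>Within a column the multipliers differ by \<open>R $ 1 / R $ 2\<close>, between columns
  by a quotient of the \<open>\<sigma> $ j\<close>: \<open>c12\<close> is non-resonance of
  \<open>R\<close> and \<open>cd\<close> that of \<sigma>.\<close>

lemma column_pencil:
  assumes k: "k \<in> {1..4}" and j: "j \<noteq> j'"
  shows "pencil q (\<lambda>i. x (perm k i)) (\<lambda>i. R $ i / \<sigma> $ j) (\<lambda>i. R $ i / \<sigma> $ j')"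
proof
  show "x (perm k 0) * x (perm k 1) * x (perm k 2) * x (perm k 3) = R $ 1 / \<sigma> $ j * (R $ 2 / \<sigma> $ j')"
    unfolding perm_prod[OF k] using j by (intro prod_two) auto
  show "R $ 1 / \<sigma> $ j * (R $ 2 / \<sigma> $ j') = R $ 2 / \<sigma> $ j * (R $ 1 / \<sigma> $ j')"
    by simp
  show "\<not> qequiv q (R $ 1 / \<sigma> $ j) (R $ 2 / \<sigma> $ j)"
    using R12 by (simp add: qequiv_same_\<sigma>)
  show "\<not> qequiv q (R $ a / \<sigma> $ j) (R $ a / \<sigma> $ j')" for a
    using \<sigma>_distinct[of j' j] j by (simp add: qequiv_same_R)
qed (use R_nonzero \<sigma>_nonzero in \<open>simp_all add: perm_generic[OF k]\<close>)

text \<open>The transposed situation: \<open>c12\<close> is now non-resonance of \<sigma> and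
  \<open>cd\<close> that of \<open>R\<close>.\<close>

lemma row_pencil:
  assumes k: "k \<in> {1..4}" and i: "i \<noteq> i'"
  shows "pencil q (\<lambda>i. x (perm k i)) (\<lambda>j. R $ i / \<sigma> $ j) (\<lambda>j. R $ i' / \<sigma> $ j)"
proof
  show "x (perm k 0) * x (perm k 1) * x (perm k 2) * x (perm k 3) = R $ i / \<sigma> $ 1 * (R $ i' / \<sigma> $ 2)"
    unfolding perm_prod[OF k] using i by (intro prod_two) auto
  show "R $ i / \<sigma> $ 1 * (R $ i' / \<sigma> $ 2) = R $ i / \<sigma> $ 2 * (R $ i' / \<sigma> $ 1)"
    by simp
  show "\<not> qequiv q (R $ i / \<sigma> $ 1) (R $ i / \<sigma> $ 2)"
    using \<sigma>_distinct[of 2 1] by (simp add: qequiv_same_R)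
  show "\<not> qequiv q (R $ i / \<sigma> $ a) (R $ i' / \<sigma> $ a)" for a
    using R_distinct i by (simp add: qequiv_same_\<sigma>)
qed (use R_nonzero \<sigma>_nonzero in \<open>simp_all add: perm_generic[OF k]\<close>)

section \<open>Entries and rank of the matrices in F\<close>

lemma F_entry:
  assumes "M \<in> F"
  shows "(\<lambda>z. M z $ i $ j) \<in> qspace 2 (R $ i / \<sigma> $ j)" "M 0 $ i $ j = 0"
  using assms by (auto simp: F_set_def V_space_def theta_space_eq)

lemma F_det:
  assumes "M \<in> F"
  shows "k \<in> {1..4} \<Longrightarrow> det (M (x k)) = 0" "\<exists>z. z \<noteq> 0 \<and> det (M z) \<noteq> 0"
proof -
  show "k \<in> {1..4} \<Longrightarrow> det (M (x k)) = 0" using assms by (simp add: F_set_def)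
  obtain z where z: "det (M z) \<noteq> 0" using assms by (auto simp: F_set_def)
  then have "z \<noteq> 0" using F_entry(2)[OF assms] by (auto simp: det2)
  with z show "\<exists>z. z \<noteq> 0 \<and> det (M z) \<noteq> 0" by blast
qed

lemma two_zeros:
  assumes "m \<in> qspace 2 (R $ i / \<sigma> $ j)" "k \<in> {1..4}" "l \<in> {1..4}" "k \<noteq> l" "m (x k) = 0" "m (x l) = 0"
    and "z \<noteq> 0"
  shows "m z = 0"
  by (rule qspace_2_eq_0[OF assms(1), of "x k" "x l"])
     (use assms x_nonzero x_distinct nonsplit R_nonzero \<sigma>_nonzero in auto)

text \<open>If one entry vanished identically, the product of its two neighbours would be zero at
  all \<open>x k\<close>. By non-splitting each of them has at most one zero there, which three
  points already contradict.\<close>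

lemma F_entry_nonzero:
  assumes M: "M \<in> F"
  shows "\<exists>z. z \<noteq> 0 \<and> M z $ i $ j \<noteq> 0"
proof (rule ccontr)
  assume "\<not> ?thesis"
  then have 0: "M z $ i $ j = 0" if "z \<noteq> 0" for z using that by auto
  obtain i' j' where ij: "i \<noteq> i'" "j \<noteq> j'"
    using exhaust_2[of i] exhaust_2[of j] by (metis zero_neq_one)
  obtain w where w: "w \<noteq> 0" "M w $ i $ j' \<noteq> 0" "M w $ i' $ j \<noteq> 0"
    using F_det(2)[OF M] det2'[OF ij] 0 by auto
  have prod: "M (x k) $ i $ j' = 0 \<or> M (x k) $ i' $ j = 0" if "k \<in> {1..4}" for k
    using F_det(1)[OF M that] det2'[OF ij, of "M (x k)"] 0[OF x_nonzero[OF that]] by auto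
  have no1: False if "k \<in> {1..4}" "l \<in> {1..4}" "k \<noteq> l" "M (x k) $ i $ j' = 0" "M (x l) $ i $ j' = 0" for k l
    using two_zeros[OF F_entry(1)[OF M] that w(1)] w by simp
  have no2: False if "k \<in> {1..4}" "l \<in> {1..4}" "k \<noteq> l" "M (x k) $ i' $ j = 0" "M (x l) $ i' $ j = 0" for k l
    using two_zeros[OF F_entry(1)[OF M] that w(1)] w by simp
  show False
    using prod[of 1] prod[of 2] prod[of 3] no1[of 1 2] no1[of 1 3] no1[of 2 3]
      no2[of 1 2] no2[of 1 3] no2[of 2 3]
    by auto
qed

lemma F_V_star: "M \<in> F \<Longrightarrow> M \<in> V_star q R \<sigma>"
proof -
  assume M: "M \<in> F"
  then have "M \<in> V_space q R \<sigma>" by (simp add: F_set_def)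
  moreover have "\<forall>i j. \<exists>z. M z $ i $ j \<noteq> 0" using F_entry_nonzero[OF M] by blast
  ultimately show ?thesis by (simp add: V_star_def)
qed

lemma F_nonzero:
  assumes M: "M \<in> F" and k: "k \<in> {1..4}"
  shows "M (x k) \<noteq> 0"
proof
  assume 0: "M (x k) = 0"
  interpret p: pencil q "\<lambda>i. x (perm k i)" "\<lambda>i. R $ i / \<sigma> $ 1" "\<lambda>i. R $ i / \<sigma> $ 2"
    by (rule column_pencil) (use k in auto)
  obtain z where z: "z \<noteq> 0" "det (M z) \<noteq> 0" using F_det(2)[OF M] by blast
  have "M z $ 1 $ 1 * M z $ 2 $ 2 = M z $ 2 $ 1 * M z $ 1 $ 2"
  proof (rule p.det_eq_0_of_common_zero[of "\<lambda>i z. M z $ i $ 1" "\<lambda>i z. M z $ i $ 2"])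
    fix i :: nat assume "i \<in> {1, 2}"
    then have "det (M (x (perm k i))) = 0" by (intro F_det[OF M] perm_mem k) auto
    then show "M (x (perm k i)) $ 1 $ 1 * M (x (perm k i)) $ 2 $ 2
        = M (x (perm k i)) $ 2 $ 1 * M (x (perm k i)) $ 1 $ 2"
      by (simp add: det2)
  qed (use z 0 F_entry[OF M] in \<open>auto simp: perm_0\<close>)
  with z show False by (simp add: det2)
qed

section \<open>Interpolation constants and the equation of the surface\<close>

lemma theta_space_restrict:
  assumes "m \<in> qspace 2 c"
  shows "(\<lambda>z. if z = 0 then 0 else m z) \<in> theta_space q c"
proof -
  have "(\<lambda>z. if z = 0 then 0 else m z) holomorphic_on - {0}"
    by (rule holomorphic_transform[OF qspaceD(1)[OF assms]]) simp
  then show ?thesis using assms unfolding theta_space_eq by (simp add: qspace_def)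
qed

text \<open>Makes the description by \<open>THE\<close> effective: the Lagrange weights satisfy the
  relation since a difference with zeros at \<open>x 1\<close> and \<open>x 2\<close> vanishes, and
  they are unique.\<close>

lemma interp_eq:
  assumes c: "c = R $ i / \<sigma> $ j" and m: "m \<in> theta_space q c" and k: "k \<in> {1..4}"
  shows "m (x k) = lam q c x k * m (x 1) + mu q c x k * m (x 2)"
proof -
  let ?P = "\<lambda>p. \<forall>m\<in>theta_space q c. m (x k) = fst p * m (x 1) + snd p * m (x 2)"
  have xs: "x 1 \<noteq> 0" "x 2 \<noteq> 0" "x k \<noteq> 0" using x_nonzero k by auto
  have c0: "c \<noteq> 0" using c R_nonzero \<sigma>_nonzero by simp
  have nz: "qbase c (x 1) (x 2) \<noteq> 0" "qbase c (x 2) (x 1) \<noteq> 0"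
    using x_distinct[of 1 2] x_distinct[of 2 1] nonsplit[of 1 2 i j] xs c0
      qequiv_sym[of "x 1 * x 2" c] c
    by (auto simp: qbase_eq_0_iff mult.commute)
  let ?p = "(qbase c (x 2) (x k) / qbase c (x 2) (x 1), qbase c (x 1) (x k) / qbase c (x 1) (x 2))"
  have ex: "?P ?p"
  proof
    fix m assume m: "m \<in> theta_space q c"
    define n where "n z = (m (x 1) / qbase c (x 2) (x 1)) * qbase c (x 2) z
      + (m (x 2) / qbase c (x 1) (x 2)) * qbase c (x 1) z" for z
    have "n \<in> qspace 2 c" unfolding n_def [abs_def]
      by (intro qspace_lincomb qbase_in_qspace xs c0)
    then have "(\<lambda>z. 1 * m z + (- 1) * n z) \<in> qspace 2 c"
      using m by (intro qspace_lincomb) (auto simp: theta_space_eq)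
    then have "1 * m (x k) + (- 1) * n (x k) = 0"
      unfolding c by (rule two_zeros[of _ i j 1 2]) (use xs nz in \<open>auto simp: n_def\<close>)
    then have "m (x k) = n (x k)" by simp
    then show "m (x k) = fst ?p * m (x 1) + snd ?p * m (x 2)" by (simp add: n_def mult_ac)
  qed
  \<comment> \<open>The test functions \<open>qbase c (x 2)\<close> and \<open>qbase c (x 1)\<close>
    isolate the first and the second weight.\<close>
  have "p = ?p" if p: "?P p" for p
  proof -
    have "qbase c (x 2) (x k) = fst p * qbase c (x 2) (x 1) + snd p * qbase c (x 2) (x 2)"
      "qbase c (x 1) (x k) = fst p * qbase c (x 1) (x 1) + snd p * qbase c (x 1) (x 2)"
      using p[rule_format, OF theta_space_restrict[OF qbase_in_qspace]] xs c0 by auto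
    then show ?thesis using nz xs by (simp add: prod_eq_iff)
  qed
  with ex have "?P (interp q c x k)" unfolding interp_def by (rule theI)
  then show ?thesis using m by blast
qed

lemma lin_form_homs:
  "lin_form q c1 c2 x (homs p r) =
     (lam q c2 x 3 * p 1 * r 3 - lam q c1 x 3 * p 3 * r 1) * (mu q c2 x 4 * p 2 * r 4 - mu q c1 x 4 * p 4 * r 2)
   - (lam q c2 x 4 * p 1 * r 4 - lam q c1 x 4 * p 4 * r 1) * (mu q c2 x 3 * p 2 * r 3 - mu q c1 x 3 * p 3 * r 2)"
  by (simp add: lin_form_def homs_def a12_def a13_def a14_def a23_def a24_def a34_def algebra_simps)

text \<open>The first row of \<open>M\<close> is \<open>\<tau> k\<close> times the coordinates of
  \<open>\<rho>\<^sub>k\<close> at each \<open>x k\<close>. Interpolating its values at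
  \<open>x 3\<close> and \<open>x 4\<close> from \<open>x 1\<close> and \<open>x 2\<close> gives two
  homogeneous linear equations for \<open>\<tau> 1\<close> and \<open>\<tau> 2\<close>, and their
  determinant is, up to sign, the quadratic form.\<close>

lemma Phi_eq_0:
  assumes M: "M \<in> F"
  shows "lin_form q (R $ 1 / \<sigma> $ 1) (R $ 1 / \<sigma> $ 2) x (hmons (rho x M)) = 0"
proof -
  define c1 c2 where c: "c1 = R $ 1 / \<sigma> $ 1" "c2 = R $ 1 / \<sigma> $ 2"
  define m n where mn: "m z = M z $ 1 $ 1" "n z = M z $ 1 $ 2" for z
  have th: "m \<in> theta_space q c1" "n \<in> theta_space q c2"
    using M by (auto simp: F_set_def V_space_def c mn [abs_def])
  let ?p = "\<lambda>k. hx (rho x M k)" and ?r = "\<lambda>k. hy (rho x M k)"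
  have "\<exists>\<tau>. n (x k) = \<tau> * ?p k \<and> m (x k) = \<tau> * ?r k" if k: "k \<in> {1..4}" for k
  proof (cases "M (x k) $ 1 $ 2 \<noteq> 0 \<or> M (x k) $ 1 $ 1 \<noteq> 0")
    case True
    then show ?thesis using rho_coords[of M x k 1, OF F_det(1)[OF M k]] by (auto simp: mn)
  next
    case False
    then show ?thesis by (intro exI[of _ 0]) (auto simp: mn)
  qed
  then obtain \<tau> where \<tau>: "\<And>k. k \<in> {1..4} \<Longrightarrow> n (x k) = \<tau> k * ?p k" "\<And>k. k \<in> {1..4} \<Longrightarrow> m (x k) = \<tau> k * ?r k"
    by metis
  \<comment> \<open>Otherwise the entry \<open>m\<close> would have two zeros and vanish
    identically.\<close>
  have nz: "\<tau> 1 \<noteq> 0 \<or> \<tau> 2 \<noteq> 0"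
  proof (rule ccontr)
    assume "\<not> ?thesis"
    then have "m (x 1) = 0" "m (x 2) = 0" using \<tau>(2)[of 1] \<tau>(2)[of 2] by auto
    then have "m z = 0" if "z \<noteq> 0" for z
      using two_zeros[OF F_entry(1)[OF M, of 1 1], of 1 2 z] that by (simp add: mn)
    then show False using F_entry_nonzero[OF M, of 1 1] by (auto simp: mn)
  qed
  let ?A = "\<lambda>k. ?p k * lam q c1 x k * ?r 1 - ?r k * lam q c2 x k * ?p 1"
  let ?B = "\<lambda>k. ?p k * mu q c1 x k * ?r 2 - ?r k * mu q c2 x k * ?p 2"
  have eq: "\<tau> 1 * ?A k + \<tau> 2 * ?B k = 0" if k: "k \<in> {1..4}" for k
  proof -
    have "?p k * m (x k) = ?r k * n (x k)" using \<tau>[OF k] by simp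
    then have "?p k * (lam q c1 x k * m (x 1) + mu q c1 x k * m (x 2))
        = ?r k * (lam q c2 x k * n (x 1) + mu q c2 x k * n (x 2))"
      using interp_eq[OF c(1) th(1) k] interp_eq[OF c(2) th(2) k] by simp
    then show ?thesis using \<tau>[of 1] \<tau>[of 2] by (simp add: algebra_simps)
  qed
  have e3: "\<tau> 1 * ?A 3 + \<tau> 2 * ?B 3 = 0" and e4: "\<tau> 1 * ?A 4 + \<tau> 2 * ?B 4 = 0"
    by (rule eq; simp)+
  have "\<tau> 1 * (?A 3 * ?B 4 - ?A 4 * ?B 3) = 0" "\<tau> 2 * (?A 3 * ?B 4 - ?A 4 * ?B 3) = 0"
    using e3 e4 by algebra+
  with nz have "?A 3 * ?B 4 - ?A 4 * ?B 3 = 0" by auto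
  then show ?thesis
    unfolding hmons_eq_homs lin_form_homs c[symmetric] o_def by (simp add: algebra_simps)
qed

lemma eta_in_Y_surf:
  assumes M: "M \<in> F"
  shows "\<eta> M \<in> Y_surf q R \<sigma> x"
proof -
  let ?\<rho> = "rho x M"
  have 0: "lin_form q (R $ 1 / \<sigma> $ 1) (R $ 1 / \<sigma> $ 2) x (\<eta> M) = 0"
    using Phi_eq_0[OF M] by (simp add: eta_eq lin_form_scale6)
  have 1: "lin_form q (R $ 1 / \<sigma> $ 2) (R $ 1 / \<sigma> $ 2) x (\<eta> M) = 1"
    using Phi'_nonzero[OF M] by (simp add: eta_eq lin_form_scale6 Phi'_def)
  obtain e12 e13 e14 e23 e24 e34 where e: "\<eta> M = (e12, e13, e14, e23, e24, e34)"
    by (metis prod_cases6)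
  have "e12 * e34 - e13 * e24 = 0" "e13 * e24 - e14 * e23 = 0"
    using e by (auto simp: eta_eq hmons_eq_homs homs_def scale6_def)
  then show ?thesis using 0 1 unfolding e by (simp add: Y_surf_def)
qed

section \<open>Descent to the quotient\<close>

lemma H_orbit_F:
  assumes M: "M \<in> F" and N: "N \<in> H_orbit q R \<sigma> M"
  shows "\<eta> N = \<eta> M"
    and "k \<in> {1..4} \<Longrightarrow> (rho x N k = Fin 0 \<longleftrightarrow> rho x M k = Fin 0) \<and> (rho x N k = Infty \<longleftrightarrow> rho x M k = Infty) \<and>
      (rho' x N k = Fin 0 \<longleftrightarrow> rho' x M k = Fin 0) \<and> (rho' x N k = Infty \<longleftrightarrow> rho' x M k = Infty)"
proof -
  obtain \<gamma> \<epsilon> where \<gamma>\<epsilon>: "\<And>i. \<gamma> i \<noteq> 0" "\<And>i. \<epsilon> i \<noteq> 0" "\<And>z i j. N z $ i $ j = \<gamma> i * M z $ i $ j * \<epsilon> j"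
    using H_orbit_entries[OF N] by metis
  have detN: "det (N (x k)) = 0" if "k \<in> {1..4}" for k
    using F_det(1)[OF M that] by (simp add: det2 \<gamma>\<epsilon>(3))
  have nzN: "N (x k) \<noteq> 0" if "k \<in> {1..4}" for k
    using F_nonzero[OF M that] \<gamma>\<epsilon> by (auto simp: vec_eq_iff)
  have "\<exists>\<kappa>. \<kappa> \<noteq> 0 \<and> hmons (rho x N) = scale6 \<kappa> (homs (hx \<circ> rho x M) (hy \<circ> rho x M))"
  \<comment> \<open>Row factors \<gamma> disappear in the scaling at each point; column factors
    \<epsilon> are common to all points and scale the monomials together.\<close>
  proof (rule hmons_rho[where a = "\<epsilon> 1" and b = "\<epsilon> 2"])
    fix m :: nat assume m: "m \<in> {1..4}"
    obtain i where i: "M (x m) $ i $ 2 \<noteq> 0 \<or> M (x m) $ i $ 1 \<noteq> 0"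
      using F_nonzero[OF M m] by (auto simp: vec_eq_iff forall_2)
    from rho_coords[of M x m i, OF F_det(1)[OF M m] i] obtain \<tau> where
      \<tau>: "\<tau> \<noteq> 0" "M (x m) $ i $ 2 = \<tau> * hx (rho x M m)" "M (x m) $ i $ 1 = \<tau> * hy (rho x M m)"
      by blast
    then show "\<exists>i \<tau>. \<tau> \<noteq> 0 \<and> N (x m) $ i $ 1 = \<tau> * \<epsilon> 1 * (hy \<circ> rho x M) m \<and>
        N (x m) $ i $ 2 = \<tau> * \<epsilon> 2 * (hx \<circ> rho x M) m"
      using \<gamma>\<epsilon> by (intro exI[of _ i] exI[of _ "\<gamma> i * \<tau>"]) (auto simp: mult_ac)
    show "(hy \<circ> rho x M) m \<noteq> 0 \<or> (hx \<circ> rho x M) m \<noteq> 0"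
      by (simp add: hx_eq_0_iff hy_eq_0_iff)
  qed (use detN \<gamma>\<epsilon> in auto)
  then show "\<eta> N = \<eta> M"
    using eta_of_scaled[of "rho x N" _ "hmons (rho x M)"]
    by (auto simp: eta_eq Phi'_def simp flip: hmons_eq_homs)
  show "(rho x N k = Fin 0 \<longleftrightarrow> rho x M k = Fin 0) \<and> (rho x N k = Infty \<longleftrightarrow> rho x M k = Infty) \<and>
      (rho' x N k = Fin 0 \<longleftrightarrow> rho' x M k = Fin 0) \<and> (rho' x N k = Infty \<longleftrightarrow> rho' x M k = Infty)"
    if k: "k \<in> {1..4}"
    using rho_eq_iff[of N x k, OF detN[OF k] nzN[OF k]]
      rho_eq_iff[of M x k, OF F_det(1)[OF M k] F_nonzero[OF M k]]
      rho'_eq_iff[of N x k, OF detN[OF k] nzN[OF k]]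
      rho'_eq_iff[of M x k, OF F_det(1)[OF M k] F_nonzero[OF M k]] \<gamma>\<epsilon>
    by (simp add: \<gamma>\<epsilon>(3))
qed

text \<open>An orbit-invariant condition may be tested on one representative, and \<eta> is constant
  on orbits; so the image of a locus can be computed in \<open>F\<close> without the
  quotient.\<close>

lemma theta'_locus:
  assumes P: "\<And>M N. M \<in> F \<Longrightarrow> N \<in> H_orbit q R \<sigma> M \<Longrightarrow> P N \<longleftrightarrow> P M"
  shows "theta' q R \<sigma> x ` {\<O> \<in> F_quot q R \<sigma> x. \<forall>M\<in>\<O>. P M} = (\<lambda>M. pr4 (\<eta> M)) ` {M \<in> F. P M}"
proof -
  have th: "theta' q R \<sigma> x (H_orbit q R \<sigma> M) = pr4 (\<eta> M)" if M: "M \<in> F" for M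
  proof -
    have "(\<lambda>N. \<eta> N) ` H_orbit q R \<sigma> M = {\<eta> M}"
    proof (intro equalityI subsetI)
      fix w assume "w \<in> {\<eta> M}"
      then show "w \<in> (\<lambda>N. \<eta> N) ` H_orbit q R \<sigma> M"
        using H_orbit_self[OF F_V_star[OF M]] by blast
    qed (auto simp: H_orbit_F(1)[OF M])
    then show ?thesis by (simp add: theta'_def theta_def)
  qed
  have "{\<O> \<in> F_quot q R \<sigma> x. \<forall>M\<in>\<O>. P M} = H_orbit q R \<sigma> ` {M \<in> F. P M}"
  proof (intro equalityI subsetI)
    fix \<O> assume "\<O> \<in> {\<O> \<in> F_quot q R \<sigma> x. \<forall>M\<in>\<O>. P M}"
    then obtain M where "M \<in> F" "\<O> = H_orbit q R \<sigma> M" "\<forall>M\<in>\<O>. P M"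
      by (auto simp: F_quot_def)
    then show "\<O> \<in> H_orbit q R \<sigma> ` {M \<in> F. P M}"
      using H_orbit_self[OF F_V_star] by blast
  next
    fix \<O> assume "\<O> \<in> H_orbit q R \<sigma> ` {M \<in> F. P M}"
    then obtain M where "M \<in> F" "\<O> = H_orbit q R \<sigma> M" "P M"
      by blast
    then show "\<O> \<in> {\<O> \<in> F_quot q R \<sigma> x. \<forall>M\<in>\<O>. P M}"
      using P by (auto simp: F_quot_def)
  qed
  then show ?thesis by (auto simp: image_image th intro!: image_cong)
qed

text \<open>The common core of both cases: \<open>e s t\<close> are coordinates linear in
  \<open>(s, t)\<close>, and \<open>a\<close>, \<open>b\<close> are the coefficients of \<delta>.
  Admissible pairs fill a projective line without the zero of \<delta>, and normalizing
  \<open>Phi'\<close> to 1 turns it into an affine line.\<close>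

lemma image_line:
  assumes S: "S \<subseteq> F"
    and e: "\<And>s t. e s t = scale6 s (e 1 0) + scale6 t (e 0 1)" "\<And>s t. e s t = 0 \<Longrightarrow> s = 0 \<and> t = 0"
    and nz: "a \<noteq> 0 \<or> b \<noteq> 0"
    and 1: "\<And>M. M \<in> S \<Longrightarrow> \<exists>s t \<kappa>. s * a + t * b \<noteq> 0 \<and> \<kappa> \<noteq> 0 \<and> hmons (rho x M) = scale6 \<kappa> (e s t)"
    and 2: "\<And>s t. s * a + t * b \<noteq> 0 \<Longrightarrow> \<exists>M\<in>S. \<exists>\<kappa>. \<kappa> \<noteq> 0 \<and> hmons (rho x M) = scale6 \<kappa> (e s t)"
  shows "affine_line ((\<lambda>M. pr4 (\<eta> M)) ` S)"
proof -
  define L where "L = lin_form q (R $ 1 / \<sigma> $ 2) (R $ 1 / \<sigma> $ 2) x"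
  define u v where uv: "u = L (e 1 0)" "v = L (e 0 1)"
  have L: "L (e s t) = s * u + t * v" for s t
    unfolding uv L_def by (subst e(1)) (simp add: lin_form_add lin_form_scale6)
  have eta_L: "\<eta> M = scale6 (1 / L (e s t)) (e s t)"
    if "\<kappa> \<noteq> 0" "hmons (rho x M) = scale6 \<kappa> (e s t)" for M \<kappa> s t
    using eta_of_scaled[OF that(2,1)] by (simp add: L_def)
  have impl: "s * u + t * v \<noteq> 0" if "s * a + t * b \<noteq> 0" for s t
  proof -
    from 2[OF that] obtain M \<kappa> where
      M: "M \<in> S" "\<kappa> \<noteq> 0" "hmons (rho x M) = scale6 \<kappa> (e s t)" by blast
    have "Phi' q R \<sigma> x (rho x M) = \<kappa> * L (e s t)"
      by (simp add: Phi'_def M L_def lin_form_scale6)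
    then show ?thesis using Phi'_nonzero[of M] M S by (auto simp: L)
  qed
  have impl': "s * a + t * b \<noteq> 0" if "s * u + t * v \<noteq> 0" for s t
    by (rule linear_forms_proportional[OF nz impl that])
  have e_scale: "scale6 \<kappa> (e s t) = e (\<kappa> * s) (\<kappa> * t)" for \<kappa> s t
    by (subst (1 2) e(1)) (auto simp: scale6_def algebra_simps split: prod.split)
  have e_add: "e (s + s') (t + t') = e s t + e s' t'" for s t s' t'
    by (subst (1 2 3) e(1)) (auto simp: scale6_def algebra_simps split: prod.split)
  have image: "\<eta> ` S = {e s t |s t. s * u + t * v = 1}"
  proof (intro set_eqI iffI)
    fix w assume "w \<in> \<eta> ` S"
    then obtain M where M: "M \<in> S" "w = \<eta> M" by blast
    from 1[OF M(1)] obtain s t \<kappa> where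
      st: "s * a + t * b \<noteq> 0" "\<kappa> \<noteq> 0" "hmons (rho x M) = scale6 \<kappa> (e s t)" by blast
    let ?l = "s * u + t * v"
    have "w = e (1 / ?l * s) (1 / ?l * t)" using eta_L[OF st(2,3)] M by (simp add: L e_scale)
    moreover have "(1 / ?l * s) * u + (1 / ?l * t) * v = 1"
      using impl[OF st(1)] by (simp flip: add_divide_distrib)
    ultimately show "w \<in> {e s t |s t. s * u + t * v = 1}" by blast
  next
    fix w assume "w \<in> {e s t |s t. s * u + t * v = 1}"
    then obtain s t where st: "w = e s t" "s * u + t * v = 1" by blast
    then have "s * a + t * b \<noteq> 0" using impl'[of s t] by simp
    from 2[OF this] obtain M \<kappa> where M: "M \<in> S" "\<kappa> \<noteq> 0" "hmons (rho x M) = scale6 \<kappa> (e s t)" by blast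
    then have "\<eta> M = w" using eta_L[OF M(2,3)] st by (simp add: L)
    then show "w \<in> \<eta> ` S" using M by blast
  qed
  obtain s0 t0 where st0: "s0 * u + t0 * v = 1"
  proof -
    have "u \<noteq> 0 \<or> v \<noteq> 0" using impl[of 1 0] impl[of 0 1] nz by auto
    then have "1 / u * u + 0 * v = 1 \<or> 0 * u + 1 / v * v = 1" by auto
    then show ?thesis using that by blast
  qed
  have param: "{e s t |s t. s * u + t * v = 1} = range (\<lambda>\<tau>. e s0 t0 + scale6 \<tau> (e v (- u)))"
  proof (intro set_eqI iffI)
    fix w assume "w \<in> {e s t |s t. s * u + t * v = 1}"
    then obtain s t where st: "w = e s t" "s * u + t * v = 1" by blast
    \<comment> \<open>Cramer's rule for the coordinate of \<open>(s, t)\<close> along the kernel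
      direction \<open>(v, - u)\<close> of \<open>Phi'\<close>.\<close>
    define \<tau> where "\<tau> = s * t0 - t * s0"
    have "s = s0 + \<tau> * v" "t = t0 + \<tau> * (- u)"
      unfolding \<tau>_def using st(2) st0 by algebra+
    then have "w = e s0 t0 + scale6 \<tau> (e v (- u))" using st(1) by (simp only: e_scale e_add)
    then show "w \<in> range (\<lambda>\<tau>. e s0 t0 + scale6 \<tau> (e v (- u)))" by blast
  next
    fix w assume "w \<in> range (\<lambda>\<tau>. e s0 t0 + scale6 \<tau> (e v (- u)))"
    then obtain \<tau> where "w = e s0 t0 + scale6 \<tau> (e v (- u))" by blast
    then have "w = e (s0 + \<tau> * v) (t0 + \<tau> * (- u))" by (simp only: e_scale e_add)
    moreover have "(s0 + \<tau> * v) * u + (t0 + \<tau> * (- u)) * v = 1" using st0 by algebra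
    ultimately show "w \<in> {e s t |s t. s * u + t * v = 1}" by blast
  qed
  have Y: "e s0 t0 + scale6 \<tau> (e v (- u)) \<in> Y_surf q R \<sigma> x" for \<tau>
  proof -
    have "e s0 t0 + scale6 \<tau> (e v (- u)) \<in> \<eta> ` S"
      unfolding image param by (rule rangeI)
    then obtain M where "M \<in> S" "e s0 t0 + scale6 \<tau> (e v (- u)) = \<eta> M"
      by (rule imageE)
    then show ?thesis using eta_in_Y_surf[of M] S by (simp add: subset_iff)
  qed
  \<comment> \<open>If the direction were projected to 0, the points with parameters 0 and 1 would
    have the same projection. They lie on \<open>Y_surf\<close>, where the projection is injective,
    so \<open>e v (- u)\<close> and with it \<open>u\<close> and \<open>v\<close> would
    vanish.\<close>
  have "pr4 (e v (- u)) \<noteq> 0"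
  proof
    assume 0: "pr4 (e v (- u)) = 0"
    have "e s0 t0 + scale6 0 (e v (- u)) = e s0 t0 + scale6 1 (e v (- u))"
      by (rule inj_onD[OF bij_betw_imp_inj_on[OF bij_betw_pr4[OF elim_nonzero]] _ Y Y])
         (simp add: pr4_add pr4_scale6 0)
    then have "scale6 0 (e v (- u)) = e v (- u)" by simp
    then have "e (0 * v) (0 * (- u)) = e v (- u)" unfolding e_scale .
    moreover have "e 0 0 = 0" using e_add[of 0 0 0 0] by simp
    ultimately have "v = 0 \<and> - u = 0" by (intro e(2)) simp
    with st0 show False by simp
  qed
  moreover have "(\<lambda>M. pr4 (\<eta> M)) ` S = range (\<lambda>\<tau>. pr4 (e s0 t0) + \<tau> *s pr4 (e v (- u)))"
  proof -
    have "(\<lambda>M. pr4 (\<eta> M)) ` S = pr4 ` (\<eta> ` S)" by (simp add: image_image)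
    then show ?thesis unfolding image param by (simp add: image_image pr4_add pr4_scale6)
  qed
  ultimately show ?thesis
    unfolding affine_line_def
    by (intro exI[of _ "pr4 (e s0 t0)"] exI[of _ "pr4 (e v (- u))"]) (rule conjI)
qed

text \<open>Here \<open>\<rho>\<^sub>k\<close> is constant, and the line is traced out by the ratios
  \<open>W\<close> at the other three points, two of which are \<open>s\<close> and \<open>t\<close>
  themselves.\<close>

lemma column_line:
  assumes k: "k \<in> {1..4}" and j: "j \<noteq> j'"
  shows "affine_line ((\<lambda>M. pr4 (\<eta> M)) ` {M \<in> F. \<forall>i. M (x k) $ i $ j = 0})"
proof -
  interpret p: pencil q "\<lambda>i. x (perm k i)" "\<lambda>i. R $ i / \<sigma> $ j" "\<lambda>i. R $ i / \<sigma> $ j'"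
    by (rule column_pencil[OF k j])
  define col where
    "col s t a = (if a = j then (\<lambda>_. 1)(k := 0) else (\<lambda>m. p.W (x m) s t)(k := 1))" for s t and a :: 2
  define e where "e s t = homs (col s t 2) (col s t 1)" for s t
  have jj: "j = 1 \<and> j' = 2 \<or> j = 2 \<and> j' = 1" using exhaust_2[of j] exhaust_2[of j'] j by auto
  have key: "\<exists>\<kappa>. \<kappa> \<noteq> 0 \<and> hmons (rho x M) = scale6 \<kappa> (e s t)"
    if M: "M \<in> F" and \<alpha>: "\<And>i. \<alpha> i \<noteq> 0" and Mj: "\<And>i z. z \<noteq> 0 \<Longrightarrow> M z $ i $ j = \<alpha> i * p.f i z"
      and Mj': "\<And>i z. z \<noteq> 0 \<Longrightarrow> M z $ i $ j' = \<alpha> i * p.g i s t z" for M \<alpha> s t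
    unfolding e_def
  proof (rule hmons_rho[where a = 1 and b = 1])
    fix m :: nat assume m: "m \<in> {1..4}"
    show "col s t 1 m \<noteq> 0 \<or> col s t 2 m \<noteq> 0" using jj by (auto simp: col_def)
    \<comment> \<open>At \<open>x k\<close> a row is used whose other entry is nonzero, which exists
      because the rank is 1; elsewhere the first row serves, since \<open>f\<close> does not vanish
      there.\<close>
    have "\<exists>i \<tau>. \<tau> \<noteq> 0 \<and> M (x m) $ i $ j = \<tau> * col s t j m \<and> M (x m) $ i $ j' = \<tau> * col s t j' m"
    proof (cases "m = k")
      case True
      have 0: "M (x k) $ i $ j = 0" for i
        using Mj[OF x_nonzero[OF k], of i] p.f_0[of i] by (simp add: perm_0)
      obtain i where "M (x k) $ i $ j' \<noteq> 0"
        using F_nonzero[OF M k] jj 0 by (auto simp: vec_eq_iff forall_2)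
      then show ?thesis using True 0 j by (intro exI[of _ i] exI[of _ "M (x k) $ i $ j'"]) (simp add: col_def)
    next
      case False
      obtain i where i: "0 < i" "i < 4" "perm k i = m" using perm_cover[OF k m False] by metis
      have "p.g 1 s t (x m) = p.W (x m) s t * p.f 1 (x m)" using p.g_W[OF i(1,2), of 1 s t] i(3) by simp
      moreover have "p.f 1 (x m) \<noteq> 0" using p.f_nonzero[OF i(1,2), of 1] i(3) by simp
      ultimately show ?thesis
        using False j \<alpha>[of 1] Mj[OF x_nonzero[OF m], of 1] Mj'[OF x_nonzero[OF m], of 1]
        by (intro exI[of _ 1] exI[of _ "\<alpha> 1 * p.f 1 (x m)"]) (simp add: col_def)
    qed
    then show "\<exists>i \<tau>. \<tau> \<noteq> 0 \<and> M (x m) $ i $ 1 = \<tau> * 1 * col s t 1 m \<and> M (x m) $ i $ 2 = \<tau> * 1 * col s t 2 m"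
      using jj by auto
  qed (use F_det(1)[OF M] in auto)
  show ?thesis
  proof (rule image_line[where e = e and a = "p.\<delta> 1 0" and b = "p.\<delta> 0 1"])
    show "e s t = scale6 s (e 1 0) + scale6 t (e 0 1)" for s t
      using jj homs_linear_off[OF k, of "\<lambda>m. p.W (x m) s t" s "\<lambda>m. p.W (x m) 1 0" t
        "\<lambda>m. p.W (x m) 0 1", OF p.W_linear]
      by (auto simp: e_def col_def)
    show "s = 0 \<and> t = 0" if 0: "e s t = 0" for s t
    proof -
      have "p.W (x m) s t = 0" if "m \<in> {1..4}" "m \<noteq> k" for m
        using homs_off_eq_0[OF k that, where w = "\<lambda>m. p.W (x m) s t"] jj 0 by (auto simp: e_def col_def)
      from this[of "perm k 1"] this[of "perm k 2"] show ?thesis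
        using perm_mem[OF k, of 1] perm_mem[OF k, of 2] perm_eq_iff[OF k, of _ 0] p.W_1[of s t] p.W_2[of s t]
        by (simp add: perm_0)
    qed
    show "p.\<delta> 1 0 \<noteq> 0 \<or> p.\<delta> 0 1 \<noteq> 0" by (rule p.\<delta>_nonzero)
  next
    fix M assume "M \<in> {M \<in> F. \<forall>i. M (x k) $ i $ j = 0}"
    then have M: "M \<in> F" "\<And>i. M (x k) $ i $ j = 0" by auto
    obtain \<alpha> s t where \<alpha>: "\<And>a. \<alpha> a \<noteq> 0" "\<And>a z. z \<noteq> 0 \<Longrightarrow> M z $ a $ j = \<alpha> a * p.f a z"
      "\<And>a z. z \<noteq> 0 \<Longrightarrow> M z $ a $ j' = \<alpha> a * p.g a s t z"
    proof (rule p.representation[of "\<lambda>a z. M z $ a $ j" "\<lambda>a z. M z $ a $ j'"])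
      fix i :: nat assume "i \<in> {1, 2}"
      then have "det (M (x (perm k i))) = 0" by (intro F_det[OF M(1)] perm_mem k) auto
      then show "M (x (perm k i)) $ 1 $ j * M (x (perm k i)) $ 2 $ j'
        = M (x (perm k i)) $ 2 $ j * M (x (perm k i)) $ 1 $ j'"
        using det2'[of 1 2 j j' "M (x (perm k i))"] j by (simp add: mult.commute)
    qed (use F_entry[OF M(1)] F_entry_nonzero[OF M(1)] M(2) in \<open>auto simp: perm_0\<close>)
    obtain z where z: "z \<noteq> 0" "det (M z) \<noteq> 0" using F_det(2)[OF M(1)] by blast
    have "p.\<delta> s t \<noteq> 0"
      using z det2'[of 1 2 j j' "M z"] j \<alpha>(2,3)[OF z(1)] p.det_f_g[OF z(1), of s t] by auto
    then show "\<exists>s t \<kappa>. s * p.\<delta> 1 0 + t * p.\<delta> 0 1 \<noteq> 0 \<and> \<kappa> \<noteq> 0 \<and> hmons (rho x M) = scale6 \<kappa> (e s t)"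
      using key[OF M(1) \<alpha>] p.\<delta>_linear[of s t] by metis
  next
    fix s t assume "s * p.\<delta> 1 0 + t * p.\<delta> 0 1 \<noteq> 0"
    then have \<delta>: "p.\<delta> s t \<noteq> 0" using p.\<delta>_linear[of s t] by simp
    \<comment> \<open>A preimage for each admissible \<open>(s, t)\<close>, with all row factors
      equal to 1; the value at 0 is the convention of \<open>theta_space\<close>. As
      \<open>\<delta> \<noteq> 0\<close>, its determinant has the zeros of \<Theta>.\<close>
    define M :: "complex \<Rightarrow> complex ^ 2 ^ 2" where
      "M z = (\<chi> i a. if z = 0 then 0 else if a = j then p.f i z else p.g i s t z)" for z
    have detM: "det (M z) = 0 \<longleftrightarrow> p.\<Theta> z = 0" if "z \<noteq> 0" for z
      using det2'[of 1 2 j j' "M z"] j p.det_f_g[OF that, of s t] \<delta> that by (auto simp: M_def mult.commute)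
    have "M \<in> V_space q R \<sigma>"
      unfolding V_space_def
    proof (safe)
      fix i a :: 2
      have "a = j \<or> a = j'" using jj exhaust_2[of a] by auto
      then show "(\<lambda>z. M z $ i $ a) \<in> theta_space q (R $ i / \<sigma> $ a)"
        using theta_space_restrict[OF p.f_in_qspace[of i]] theta_space_restrict[OF p.g_in_qspace[of i s t]] j
        by (auto simp: M_def cong: if_cong)
    qed
    moreover have "\<exists>z. det (M z) \<noteq> 0" using p.\<Theta>_nonzero detM by metis
    moreover have "det (M (x m)) = 0" if m: "m \<in> {1..4}" for m
    proof -
      obtain i where "i < 4" "perm k i = m"
        using perm_cover[OF k m] perm_0[of k] by (metis zero_less_numeral)
      then show ?thesis using detM[OF x_nonzero[OF m]] p.\<Theta>_y[of i] by simp
    qed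
    ultimately have M: "M \<in> F" by (simp add: F_set_def)
    moreover have "\<forall>i. M (x k) $ i $ j = 0" using p.f_0 by (simp add: M_def perm_0)
    moreover have "\<exists>\<kappa>. \<kappa> \<noteq> 0 \<and> hmons (rho x M) = scale6 \<kappa> (e s t)"
      by (rule key[OF M, of "\<lambda>_. 1"]) (use j in \<open>auto simp: M_def\<close>)
    ultimately show "\<exists>M\<in>{M \<in> F. \<forall>i. M (x k) $ i $ j = 0}. \<exists>\<kappa>. \<kappa> \<noteq> 0 \<and> hmons (rho x M) = scale6 \<kappa> (e s t)"
      by blast
  qed auto
qed

text \<open>At the points other than \<open>x k\<close> the ratios are read from the prescribed row
  and do not depend on \<open>(s, t)\<close>. At \<open>x k\<close> this row is zero, so
  \<open>\<rho>\<^sub>k\<close> is read from the other row, whose values are linear in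
  \<open>(s, t)\<close>.\<close>

lemma row_line:
  assumes k: "k \<in> {1..4}" and i: "i \<noteq> i'"
  shows "affine_line ((\<lambda>M. pr4 (\<eta> M)) ` {M \<in> F. \<forall>j. M (x k) $ i $ j = 0})"
proof -
  interpret p: pencil q "\<lambda>i. x (perm k i)" "\<lambda>j. R $ i / \<sigma> $ j" "\<lambda>j. R $ i' / \<sigma> $ j"
    by (rule row_pencil[OF k i])
  define crd where "crd s t a = (\<lambda>m. p.f a (x m))(k := p.g a s t (x k))" for s t and a :: 2
  define e where "e s t = homs (crd s t 2) (crd s t 1)" for s t
  have ii: "i = 1 \<and> i' = 2 \<or> i = 2 \<and> i' = 1" using exhaust_2[of i] exhaust_2[of i'] i by auto
  have f_x: "p.f a (x m) \<noteq> 0" if "m \<in> {1..4}" "m \<noteq> k" for a m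
    using perm_cover[OF k that] p.f_nonzero by metis
  have key: "\<exists>\<kappa>. \<kappa> \<noteq> 0 \<and> hmons (rho x M) = scale6 \<kappa> (e s t)"
    if M: "M \<in> F" and \<alpha>: "\<And>a. \<alpha> a \<noteq> 0" and Mi: "\<And>a z. z \<noteq> 0 \<Longrightarrow> M z $ i $ a = \<alpha> a * p.f a z"
      and Mi': "\<And>a z. z \<noteq> 0 \<Longrightarrow> M z $ i' $ a = \<alpha> a * p.g a s t z" for M \<alpha> s t
    unfolding e_def
  \<comment> \<open>The normalizing factors \<alpha> now act on columns and take the place of the
    column scaling.\<close>
  proof (rule hmons_rho[where a = "\<alpha> 1" and b = "\<alpha> 2"])
    fix m :: nat assume m: "m \<in> {1..4}"
    have Mk: "M (x k) $ i $ a = 0" for a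
      using Mi[OF x_nonzero[OF k], of a] p.f_0[of a] by (simp add: perm_0)
    show "crd s t 1 m \<noteq> 0 \<or> crd s t 2 m \<noteq> 0"
    proof (cases "m = k")
      case True
      have "\<exists>a. M (x k) $ i' $ a \<noteq> 0"
        using F_nonzero[OF M k] ii Mk by (auto simp: vec_eq_iff forall_2)
      then obtain a where "p.g a s t (x k) \<noteq> 0"
        using Mi'[OF x_nonzero[OF k]] by auto
      then show ?thesis using True exhaust_2[of a] by (auto simp: crd_def)
    next
      case False
      then show ?thesis using f_x[OF m] by (simp add: crd_def)
    qed
    show "\<exists>i \<tau>. \<tau> \<noteq> 0 \<and> M (x m) $ i $ 1 = \<tau> * \<alpha> 1 * crd s t 1 m \<and> M (x m) $ i $ 2 = \<tau> * \<alpha> 2 * crd s t 2 m"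
      using Mi[OF x_nonzero[OF m]] Mi'[OF x_nonzero[OF m]]
      by (intro exI[of _ "if m = k then i' else i"] exI[of _ 1]) (auto simp: crd_def)
  qed (use F_det(1)[OF M] \<alpha> in auto)
  show ?thesis
  proof (rule image_line[where e = e and a = "p.\<delta> 1 0" and b = "p.\<delta> 0 1"])
    show "e s t = scale6 s (e 1 0) + scale6 t (e 0 1)" for s t
      using homs_linear_at[OF k, of "\<lambda>m. p.f 2 (x m)" s _ t _ "\<lambda>m. p.f 1 (x m)"]
      unfolding e_def crd_def p.g_linear[of 1 s t] p.g_linear[of 2 s t] by blast
    show "s = 0 \<and> t = 0" if 0: "e s t = 0" for s t
    proof -
      have "p.g 2 s t (x k) = 0 \<and> p.g 1 s t (x k) = 0"
        by (rule homs_at_eq_0[OF k _ 0[unfolded e_def crd_def]]) (use f_x in auto)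
      then have "p.g a s t (x k) = 0" for a using exhaust_2[of a] by auto
      then show ?thesis using p.g_0_independent[of s t] by (simp add: perm_0)
    qed
    show "p.\<delta> 1 0 \<noteq> 0 \<or> p.\<delta> 0 1 \<noteq> 0" by (rule p.\<delta>_nonzero)
  next
    fix M assume "M \<in> {M \<in> F. \<forall>j. M (x k) $ i $ j = 0}"
    then have M: "M \<in> F" "\<And>j. M (x k) $ i $ j = 0" by auto
    obtain \<alpha> s t where \<alpha>: "\<And>a. \<alpha> a \<noteq> 0" "\<And>a z. z \<noteq> 0 \<Longrightarrow> M z $ i $ a = \<alpha> a * p.f a z"
      "\<And>a z. z \<noteq> 0 \<Longrightarrow> M z $ i' $ a = \<alpha> a * p.g a s t z"
    proof (rule p.representation[of "\<lambda>a z. M z $ i $ a" "\<lambda>a z. M z $ i' $ a"])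
      fix l :: nat assume "l \<in> {1, 2}"
      then have "det (M (x (perm k l))) = 0" by (intro F_det[OF M(1)] perm_mem k) auto
      then show "M (x (perm k l)) $ i $ 1 * M (x (perm k l)) $ i' $ 2
        = M (x (perm k l)) $ i $ 2 * M (x (perm k l)) $ i' $ 1"
        using det2'[of i i' 1 2 "M (x (perm k l))"] i by simp
    qed (use F_entry[OF M(1)] F_entry_nonzero[OF M(1)] M(2) in \<open>auto simp: perm_0\<close>)
    obtain z where z: "z \<noteq> 0" "det (M z) \<noteq> 0" using F_det(2)[OF M(1)] by blast
    have "p.\<delta> s t \<noteq> 0"
      using z det2'[of i i' 1 2 "M z"] i \<alpha>(2,3)[OF z(1)] p.det_f_g[OF z(1), of s t] by auto
    then show "\<exists>s t \<kappa>. s * p.\<delta> 1 0 + t * p.\<delta> 0 1 \<noteq> 0 \<and> \<kappa> \<noteq> 0 \<and> hmons (rho x M) = scale6 \<kappa> (e s t)"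
      using key[OF M(1) \<alpha>] p.\<delta>_linear[of s t] by metis
  next
    fix s t assume "s * p.\<delta> 1 0 + t * p.\<delta> 0 1 \<noteq> 0"
    then have \<delta>: "p.\<delta> s t \<noteq> 0" using p.\<delta>_linear[of s t] by simp
    define M :: "complex \<Rightarrow> complex ^ 2 ^ 2" where
      "M z = (\<chi> b a. if z = 0 then 0 else if b = i then p.f a z else p.g a s t z)" for z
    have detM: "det (M z) = 0 \<longleftrightarrow> p.\<Theta> z = 0" if "z \<noteq> 0" for z
      using det2'[of i i' 1 2 "M z"] i p.det_f_g[OF that, of s t] \<delta> that by (auto simp: M_def mult.commute)
    have "M \<in> V_space q R \<sigma>"
      unfolding V_space_def
    proof (safe)
      fix b a :: 2
      have "b = i \<or> b = i'" using ii exhaust_2[of b] by auto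
      then show "(\<lambda>z. M z $ b $ a) \<in> theta_space q (R $ b / \<sigma> $ a)"
        using theta_space_restrict[OF p.f_in_qspace[of a]] theta_space_restrict[OF p.g_in_qspace[of a s t]] i
        by (auto simp: M_def cong: if_cong)
    qed
    moreover have "\<exists>z. det (M z) \<noteq> 0" using p.\<Theta>_nonzero detM by metis
    moreover have "det (M (x m)) = 0" if m: "m \<in> {1..4}" for m
    proof -
      obtain i where "i < 4" "perm k i = m"
        using perm_cover[OF k m] perm_0[of k] by (metis zero_less_numeral)
      then show ?thesis using detM[OF x_nonzero[OF m]] p.\<Theta>_y[of i] by simp
    qed
    ultimately have M: "M \<in> F" by (simp add: F_set_def)
    moreover have "\<forall>j. M (x k) $ i $ j = 0" using p.f_0 by (simp add: M_def perm_0)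
    moreover have "\<exists>\<kappa>. \<kappa> \<noteq> 0 \<and> hmons (rho x M) = scale6 \<kappa> (e s t)"
      by (rule key[OF M, of "\<lambda>_. 1"]) (use i in \<open>auto simp: M_def\<close>)
    ultimately show "\<exists>M\<in>{M \<in> F. \<forall>j. M (x k) $ i $ j = 0}. \<exists>\<kappa>. \<kappa> \<noteq> 0 \<and> hmons (rho x M) = scale6 \<kappa> (e s t)"
      by blast
  qed auto
qed

lemma locus_line:
  assumes k: "k \<in> {1..4}"
  shows "affine_line (theta' q R \<sigma> x ` rho_locus q R \<sigma> x k (Fin 0))"
    and "affine_line (theta' q R \<sigma> x ` rho_locus q R \<sigma> x k Infty)"
    and "affine_line (theta' q R \<sigma> x ` rho'_locus q R \<sigma> x k (Fin 0))"
    and "affine_line (theta' q R \<sigma> x ` rho'_locus q R \<sigma> x k Infty)"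
proof -
  note rho_iff = rho_eq_iff[of _ x k, OF F_det(1)[OF _ k] F_nonzero[OF _ k]]
  note rho'_iff = rho'_eq_iff[of _ x k, OF F_det(1)[OF _ k] F_nonzero[OF _ k]]
  have eqs: "{M \<in> F. rho x M k = Fin 0} = {M \<in> F. \<forall>i. M (x k) $ i $ 2 = 0}"
    "{M \<in> F. rho x M k = Infty} = {M \<in> F. \<forall>i. M (x k) $ i $ 1 = 0}"
    "{M \<in> F. rho' x M k = Fin 0} = {M \<in> F. \<forall>j. M (x k) $ 1 $ j = 0}"
    "{M \<in> F. rho' x M k = Infty} = {M \<in> F. \<forall>j. M (x k) $ 2 $ j = 0}"
    by (intro Collect_cong conj_cong[OF refl] rho_iff rho'_iff; assumption)+
  show "affine_line (theta' q R \<sigma> x ` rho_locus q R \<sigma> x k (Fin 0))"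
    unfolding rho_locus_def
    by (subst theta'_locus) (use H_orbit_F(2)[OF _ _ k] column_line[OF k, of 2 1] in \<open>auto simp: eqs\<close>)
  show "affine_line (theta' q R \<sigma> x ` rho_locus q R \<sigma> x k Infty)"
    unfolding rho_locus_def
    by (subst theta'_locus) (use H_orbit_F(2)[OF _ _ k] column_line[OF k, of 1 2] in \<open>auto simp: eqs\<close>)
  show "affine_line (theta' q R \<sigma> x ` rho'_locus q R \<sigma> x k (Fin 0))"
    unfolding rho'_locus_def
    by (subst theta'_locus) (use H_orbit_F(2)[OF _ _ k] row_line[OF k, of 1 2] in \<open>auto simp: eqs\<close>)
  show "affine_line (theta' q R \<sigma> x ` rho'_locus q R \<sigma> x k Infty)"
    unfolding rho'_locus_def
    by (subst theta'_locus) (use H_orbit_F(2)[OF _ _ k] row_line[OF k, of 2 1] in \<open>auto simp: eqs\<close>)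
qed

lemma theta'_in_Y':
  assumes "\<O> \<in> F_quot q R \<sigma> x"
  shows "theta' q R \<sigma> x \<O> \<in> Y'_surf q R \<sigma> x"
proof -
  \<comment> \<open>The trivial condition turns the description of loci into one of the whole
    quotient.\<close>
  have "theta' q R \<sigma> x ` {\<O> \<in> F_quot q R \<sigma> x. \<forall>M\<in>\<O>. True} = (\<lambda>M. pr4 (\<eta> M)) ` {M \<in> F. True}"
    by (rule theta'_locus) simp
  then have "theta' q R \<sigma> x \<O> \<in> (\<lambda>M. pr4 (\<eta> M)) ` F" using assms by auto
  then show ?thesis
    using eta_in_Y_surf bij_betwE[OF bij_betw_pr4[OF elim_nonzero]] by auto
qed

end

theorem proposition5p8:
  fixes q :: complex and R \<sigma> :: "complex ^ 2" and x :: "nat \<Rightarrow> complex"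
  assumes q: "q \<noteq> 0" "norm q < 1"
    and nonzero: "\<forall>i. R $ i \<noteq> 0" "\<forall>j. \<sigma> $ j \<noteq> 0" "\<forall>k\<in>{1..4}. x k \<noteq> 0"
    and NR: "\<not> qequiv q (R $ 1) (R $ 2)" "\<not> qequiv q (\<sigma> $ 1) (\<sigma> $ 2)"
      "\<forall>k\<in>{1..4}. \<forall>l\<in>{1..4}. k \<noteq> l \<longrightarrow> \<not> qequiv q (x k) (x l)"
    and FR: "x 1 * x 2 * x 3 * x 4 = R $ 1 * R $ 2 / (\<sigma> $ 1 * \<sigma> $ 2)"
    and NS: "\<forall>i j. \<forall>k\<in>{1..4}. \<forall>l\<in>{1..4}. k \<noteq> l \<longrightarrow> \<not> qequiv q (R $ i / \<sigma> $ j) (x k * x l)"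
    and elimination: "elim_det q R \<sigma> x \<noteq> 0"
    and theta_defined: "\<forall>M\<in>F_set q R \<sigma> x. Phi' q R \<sigma> x (rho x M) \<noteq> 0"
  shows "\<forall>k\<in>{1..4}.
    \<forall>L\<in>{rho_locus q R \<sigma> x k (Fin 0), rho_locus q R \<sigma> x k Infty,
        rho'_locus q R \<sigma> x k (Fin 0), rho'_locus q R \<sigma> x k Infty}.
      affine_line (theta' q R \<sigma> x ` L) \<and> theta' q R \<sigma> x ` L \<subseteq> Y'_surf q R \<sigma> x"
proof -
  interpret segre q R \<sigma> x
  proof unfold_locales
    show "R $ i \<noteq> 0" "\<sigma> $ i \<noteq> 0" for i using nonzero(1,2) by blast+
    show "x k \<noteq> 0" if "k \<in> {1..4}" for k using nonzero(3) that by blast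
    show "\<not> qequiv q (x k) (x l)" if "k \<in> {1..4}" "l \<in> {1..4}" "k \<noteq> l" for k l
      using NR(3) that by blast
    show "\<not> qequiv q (R $ i / \<sigma> $ j) (x k * x l)" if "k \<in> {1..4}" "l \<in> {1..4}" "k \<noteq> l" for k l i j
      using NS that by blast
    show "Phi' q R \<sigma> x (rho x M) \<noteq> 0" if "M \<in> F_set q R \<sigma> x" for M
      using theta_defined that by blast
  qed fact+
  show ?thesis
  proof (intro ballI conjI)
    fix k L assume k: "k \<in> {1..4}" and "L \<in> {rho_locus q R \<sigma> x k (Fin 0), rho_locus q R \<sigma> x k Infty,
        rho'_locus q R \<sigma> x k (Fin 0), rho'_locus q R \<sigma> x k Infty}"
    then consider "L = rho_locus q R \<sigma> x k (Fin 0)" | "L = rho_locus q R \<sigma> x k Infty"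
      | "L = rho'_locus q R \<sigma> x k (Fin 0)" | "L = rho'_locus q R \<sigma> x k Infty" by auto
    then show "affine_line (theta' q R \<sigma> x ` L)"
      by cases (simp_all only: locus_line[OF k])
    have "L \<subseteq> F_quot q R \<sigma> x"
      using \<open>L \<in> _\<close> by (auto simp: rho_locus_def rho'_locus_def)
    then show "theta' q R \<sigma> x ` L \<subseteq> Y'_surf q R \<sigma> x"
      using theta'_in_Y' by (auto simp: subset_iff)
  qed
qed

end
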